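(* Let $q(m,n)=am^2+bmn+cn^2$ be an indefinite integral binary quadratic form whose discriminant $\Delta(q)=b^2-4ac>0$ is not a perfect square. Let $1\le p\le\infty$ and $\lambda>0$. For $f:\mathbb{Z}\to\mathbb{C}$ define $$\mathcal{I}_{\lambda}f(n)=\sum_{m\in\mathbb{Z}\setminus\{0\}}\frac{f(q(m,n))}{|m|^{\lambda}},\qquad n\in\mathbb{Z}.$$ If either $p<\infty$ and $\lambda>1-p^{-1}$, or $p=\infty$ and $\lambda>1$, then there is a constant $C_{p,\lambda,\Delta(q)}$ depending only on $p,\lambda,\Delta(q)$ such that for all $f\in\ell^p(\mathbb{Z})$, $$\|\mathcal{I}_{\lambda}f\|_{\ell^p(\mathbb{Z})}\le C_{p,\lambda,\Delta(q)}\|f\|_{\ell^p(\mathbb{Z})}.$$ Moreover this is sharp in the following sense: (i) For every $r\in\mathbb{N}$ there exist an indefinite integral binary quadratic form $q$ with nonsquare discriminant and a nonnegative $f\in\ell^1(\mathbb{Z})$ such that $\|\mathcal{I}_{\log^r}f\|_{\ell^1}=\infty$, where $\mathcal{I}_{\log^r}f(n)=\sum_{m\in\mathbb{Z}\setminus\{0\}}\frac{f(q(m,n))}{\log^r(1+|m|)}$. (ii) For every $1<p<\infty$ there exist an indefinite integral binary quadratic form $q$ with nonsquare discriminant and a nonnegative $f\in\ell^p(\mathbb{Z})$ such that $\|\mathcal{I}_{1-p^{-1}}f\|_{\ell^p}=\infty$. (iii) For $p=\infty$ there exist an indefinite integral binary quadratic form $q$ with nonsquare discriminant and a nonnegative $f\in\ell^\infty(\mathbb{Z})$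 such that $\|\mathcal{I}_{1}f\|_{\ell^\infty}=\infty$.
   Context: An integral binary quadratic form is $q(m,n)=am^2+bmn+cn^2$ with $a,b,c\in\mathbb{Z}$, evaluated at integers $m,n$; its discriminant is $\Delta(q)=b^2-4ac$. It is called indefinite if $\Delta(q)>0$. For nonnegative $f$ the sums defining the operators are sums of nonnegative terms and are allowed to equal $+\infty$. *)

theory Defs
  imports "HOL-Analysis.Analysis"
begin

definition qf :: "int \<Rightarrow> int \<Rightarrow> int \<Rightarrow> int \<Rightarrow> int \<Rightarrow> int" where
  "qf a b c m n = a * m^2 + b * m * n + c * n^2"

definition disc :: "int \<Rightarrow> int \<Rightarrow> int \<Rightarrow> int" where
  "disc a b c = b^2 - 4 * a * c"

definition good_form :: "int \<Rightarrow> int \<Rightarrow> int \<Rightarrow> bool" where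
  "good_form a b c \<longleftrightarrow> disc a b c > 0 \<and> \<not> (\<exists>k::int. disc a b c = k^2)"

definition lp_mem :: "real \<Rightarrow> (int \<Rightarrow> 'a::real_normed_vector) \<Rightarrow> bool" where
  "lp_mem p f \<longleftrightarrow> (\<lambda>n. norm (f n) powr p) summable_on UNIV"

definition lp_norm :: "real \<Rightarrow> (int \<Rightarrow> 'a::real_normed_vector) \<Rightarrow> real" where
  "lp_norm p f = (\<Sum>\<^sub>\<infinity>n. norm (f n) powr p) powr (1 / p)"

definition linf_mem :: "(int \<Rightarrow> 'a::real_normed_vector) \<Rightarrow> bool" where
  "linf_mem f \<longleftrightarrow> bounded (range f)"

definition linf_norm :: "(int \<Rightarrow> 'a::real_normed_vector) \<Rightarrow> real" where
  "linf_norm f = (SUP n. norm (f n))"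

definition Ilam :: "int \<Rightarrow> int \<Rightarrow> int \<Rightarrow> real \<Rightarrow> (int \<Rightarrow> complex) \<Rightarrow> int \<Rightarrow> complex" where
  "Ilam a b c lam f n =
     (\<Sum>\<^sub>\<infinity>m\<in>UNIV - {0}. f (qf a b c m n) / complex_of_real (\<bar>real_of_int m\<bar> powr lam))"

definition Iw :: "int \<Rightarrow> int \<Rightarrow> int \<Rightarrow> (int \<Rightarrow> real) \<Rightarrow> (int \<Rightarrow> real) \<Rightarrow> int \<Rightarrow> ennreal" where
  "Iw a b c w f n = (\<Sum>\<^sub>\<infinity>m\<in>UNIV - {0}. ennreal (f (qf a b c m n) / w m))"

definition lp_normE :: "real \<Rightarrow> (int \<Rightarrow> ennreal) \<Rightarrow> ennreal" where
  "lp_normE p g =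
     (if \<exists>n. g n = \<infinity> then \<infinity>
      else (let S = (\<Sum>\<^sub>\<infinity>n. ennreal (enn2real (g n) powr p))
            in if S = \<infinity> then \<infinity> else ennreal (enn2real S powr (1 / p))))"

definition linf_normE :: "(int \<Rightarrow> ennreal) \<Rightarrow> ennreal" where
  "linf_normE g = (SUP n. g n)"

end

theory Submission
  imports Defs "HOL-Computational_Algebra.Primes"
begin

text \<open>
  Since \<open>4 * c * q(m, n) = (2 * c * n + b * m)^2 - D * m^2\<close>, the bounds reduce to the uniform estimate
  that the sum of \<open>m powr (- lam)\<close> over all solutions of \<open>x^2 - D * m^2 = N\<close> with \<open>m > 0\<close> is bounded
  independently of \<open>N \<noteq> 0\<close>, for each \<open>lam > 0\<close>. Solutions fall into classes labelled by pairs of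
  divisors of \<open>N\<close>; quotients \<open>(x + m * sqrt D) / (x' + m' * sqrt D)\<close> within one class have norm one and
  denominator at most \<open>4 * D\<close>, so each class grows geometrically, while the divisor bound controls
  the number of classes. This is the case \<open>p = 1\<close>; for \<open>p > 1\<close> apply it to \<open>\<bar>f\<bar> powr p\<close> after Jensen's
  inequality with weights \<open>\<bar>m\<bar> powr (- s)\<close>, \<open>s > 1\<close>.

  For the counterexamples take \<open>q = n^2 - 2 * m^2\<close>. When \<open>p > 1\<close> the row \<open>n = 0\<close> already diverges.
  When \<open>p = 1\<close> one needs integers with more representations than any power of the logarithm of their
  size: high powers of a product of many coprime numbers \<open>t^2 - 2\<close>, with conjugated factors.
\<close>

section \<open>The divisor bound\<close>

text \<open>Uniformity shapes the proof: the constant may depend on \<open>D\<close> but not on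
  \<open>a\<close>, \<open>b\<close>, \<open>c\<close>. After multiplication by \<open>4 * c\<close>
  the value of the form becomes \<open>N = 4 * c * k\<close>, so a bound uniform in \<open>N\<close>
  is exactly what is needed. That \<open>D\<close> is not a square excludes \<open>c = 0\<close>,
  and it excludes \<open>N = 0\<close> for solutions with \<open>m \<noteq> 0\<close>. The obstacle
  is that the number of classes grows with the divisors of \<open>N\<close> and has to be paid for
  by \<open>m powr (- lam)\<close>, which is small only if \<open>m\<close> is at least a power of
  \<open>\<bar>N\<bar>\<close>. Solutions with \<open>D^2 * m^4 < \<bar>N\<bar>\<close> escape this
  payment, but up to signs there is at most one of them. Growth inside a class needs no fundamental
  unit: a number \<open>u + v * sqrt D > K\<close> of norm \<open>K^2\<close> with integers
  \<open>u\<close>, \<open>v\<close> has \<open>v \<ge> 1\<close>, which gives a ratio depending on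
  \<open>D\<close> alone. The threshold \<open>1 - 1 / p\<close> comes from Jensen: the weights need
  \<open>s > 1\<close>, and the exponent \<open>lam * p - s * (p - 1)\<close> left over must be
  positive.\<close>

lemma linear_le_const_mult_two_powr:
  fixes e :: real
  assumes "e > 0"
  obtains K where "K \<ge> 1" "\<And>k::nat. real k + 1 \<le> K * 2 powr (real k * e)"
proof
  \<comment> \<open>\<open>1 + x \<le> exp x\<close> at \<open>x = k * e * ln 2\<close> gives
    \<open>1 + k * e * ln 2 \<le> 2 powr (k * e)\<close>; \<open>K\<close> absorbs the factor
    \<open>e * ln 2\<close>, and the maximum with 1 takes care of the constant term.\<close>
  define K where "K = max 1 (1 / (e * ln 2))"
  show "K \<ge> 1" by (simp add: K_def)
  fix k :: nat
  have "1 \<le> K * (e * ln 2)"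
  proof -
    have "1 = (1 / (e * ln 2)) * (e * ln 2)" using assms by simp
    also have "\<dots> \<le> K * (e * ln 2)"
      using assms by (intro mult_right_mono) (auto simp: K_def)
    finally show ?thesis .
  qed
  then have "real k * 1 \<le> real k * (K * (e * ln 2))" by (intro mult_left_mono) auto
  then have "real k + 1 \<le> K * (1 + real k * e * ln 2)"
    using \<open>K \<ge> 1\<close> by (simp add: algebra_simps)
  also have "\<dots> \<le> K * 2 powr (real k * e)"
    using \<open>K \<ge> 1\<close> exp_ge_add_one_self[of "real k * e * ln 2"]
    by (intro mult_left_mono) (auto simp: powr_def algebra_simps)
  finally show "real k + 1 \<le> K * 2 powr (real k * e)" .
qed

lemma card_divisors_prime_power_mult:
  fixes p m :: nat
  assumes "prime p" "m > 0"
  shows "card {d. d dvd p ^ k * m} \<le> (k + 1) * card {d. d dvd m}"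
proof -
  have "{d. d dvd p ^ k * m} \<subseteq> (\<lambda>(i, d). p ^ i * d) ` ({..k} \<times> {d. d dvd m})"
  proof
    fix d assume "d \<in> {d. d dvd p ^ k * m}"
    then obtain a b where "d = a * b" "a dvd p ^ k" "b dvd m"
      using division_decomp[of d "p ^ k" m] by auto
    moreover then obtain i where "i \<le> k" "a = p ^ i"
      using assms(1) by (auto simp: divides_primepow_nat)
    ultimately show "d \<in> (\<lambda>(i, d). p ^ i * d) ` ({..k} \<times> {d. d dvd m})"
      by force
  qed
  then have "card {d. d dvd p ^ k * m} \<le> card ({..k} \<times> {d. d dvd m})"
    using assms(2) by (intro surj_card_le) auto
  then show ?thesis by (simp add: card_cartesian_product)
qed

text \<open>A prime power factor \<open>p ^ k\<close> contributes \<open>k + 1 \<le> 2 ^ k \<le> p ^ (k * e)\<close> unless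
  \<open>p powr e < 2\<close>, which leaves finitely many primes, each costing a bounded factor.\<close>

lemma card_divisors_le_powr:
  fixes e :: real
  assumes "e > 0"
  obtains C where "C > 0" "\<And>n::nat. n > 0 \<Longrightarrow> real (card {d. d dvd n}) \<le> C * real n powr e"
proof -
  obtain K where K: "K \<ge> 1" "\<And>k::nat. real k + 1 \<le> K * 2 powr (real k * e)"
    using linear_le_const_mult_two_powr assms by blast
  define P where "P = {p::nat. real p powr e < 2}"
  have "p < nat \<lceil>2 powr (1 / e)\<rceil>" if "p \<in> P" for p
  proof -
    have "real p = (real p powr e) powr (1 / e)" using assms by (simp add: powr_powr)
    also have "\<dots> < 2 powr (1 / e)" using that assms by (intro powr_less_mono2) (auto simp: P_def)
    finally show ?thesis by linarith
  qed
  then have "P \<subseteq> {..<nat \<lceil>2 powr (1 / e)\<rceil>}" by auto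
  then have finP: "finite P" using finite_subset by blast
  \<comment> \<open>The exponent of \<open>K\<close> counts the exceptional primes dividing
    \<open>n\<close>. The induction can then split off one full prime power at a time, charging
    \<open>K\<close> once for each prime of \<open>P\<close>.\<close>
  have main: "n > 0 \<Longrightarrow> real (card {d. d dvd n}) \<le> K ^ card {p \<in> P. p dvd n} * real n powr e"
    for n :: nat
  proof (induction n rule: less_induct)
    case (less n)
    show ?case
    proof (cases "n = 1")
      case True
      then show ?thesis using K by simp
    next
      case False
      then obtain p where p: "prime p" "p dvd n" using prime_factor_nat by blast
      define k where "k = multiplicity p n"
      obtain m where m: "n = p ^ k * m" "\<not> p dvd m"
        using multiplicity_decompose'[of n p] prime_gt_1_nat[OF p(1)] less.prems unfolding k_def by auto
      have m0: "m > 0" using m less.prems by (cases m) auto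
      have "k > 0" using p m by (cases k) auto
      then have "p ^ k > 1" using p(1) prime_gt_1_nat[of p] by (intro one_less_power) auto
      then have "m < n" using m m0 by simp
      then have IH: "real (card {d. d dvd m}) \<le> K ^ card {p \<in> P. p dvd m} * real m powr e"
        using less.IH m0 by blast
      have sub: "{p \<in> P. p dvd m} \<subseteq> {p \<in> P. p dvd n}" using m by auto
      have step: "(real k + 1) * K ^ card {p \<in> P. p dvd m}
          \<le> K ^ card {p \<in> P. p dvd n} * (real p powr (real k * e))"
      proof (cases "p \<in> P")
        case True
        \<comment> \<open>\<open>p\<close> divides \<open>n\<close> but not \<open>m\<close>, so the
          count rises by one and supplies the extra factor \<open>K\<close>.\<close>
        have "insert p {p \<in> P. p dvd m} \<subseteq> {p \<in> P. p dvd n}" using sub True p by auto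
        then have "card (insert p {p \<in> P. p dvd m}) \<le> card {p \<in> P. p dvd n}"
          using finP by (intro card_mono) auto
        then have c: "Suc (card {p \<in> P. p dvd m}) \<le> card {p \<in> P. p dvd n}"
          using finP m by simp
        have "2 powr (real k * e) \<le> real p powr (real k * e)"
          using p(1) assms prime_ge_2_nat[of p] by (intro powr_mono2) auto
        then have "real k + 1 \<le> K * real p powr (real k * e)"
          using K by (meson mult_left_mono order_trans zero_le_one)
        then have "(real k + 1) * K ^ card {p \<in> P. p dvd m}
            \<le> K * real p powr (real k * e) * K ^ card {p \<in> P. p dvd m}"
          using K by (intro mult_right_mono) auto
        also have "\<dots> = K ^ Suc (card {p \<in> P. p dvd m}) * real p powr (real k * e)" by simp
        also have "\<dots> \<le> K ^ card {p \<in> P. p dvd n} * real p powr (real k * e)"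
          using K c by (intro mult_right_mono power_increasing) auto
        finally show ?thesis .
      next
        case False
        have "real k + 1 \<le> 2 ^ k"
        proof -
          have "real (Suc k) \<le> real (2 ^ k)"
            by (subst of_nat_le_iff) (simp add: Suc_leI)
          then show ?thesis by simp
        qed
        also have "\<dots> \<le> (real p powr e) ^ k"
          using False by (intro power_mono) (auto simp: P_def)
        also have "\<dots> = real p powr (real k * e)"
          using p(1) prime_gt_0_nat[of p] by (simp add: powr_powr mult.commute flip: powr_realpow)
        finally have 1: "real k + 1 \<le> real p powr (real k * e)" .
        have 2: "K ^ card {p \<in> P. p dvd m} \<le> K ^ card {p \<in> P. p dvd n}"
          using K sub finP by (intro power_increasing card_mono) auto
        show ?thesis using mult_mono[OF 2 1] K by (simp add: mult.commute)
      qed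
      have "real (card {d. d dvd n}) \<le> (real k + 1) * real (card {d. d dvd m})"
      proof -
        have "real (card {d. d dvd n}) \<le> real ((k + 1) * card {d. d dvd m})"
          using card_divisors_prime_power_mult[OF p(1) m0, of k] m(1) by (intro of_nat_mono) simp
        then show ?thesis by (simp add: algebra_simps)
      qed
      also have "\<dots> \<le> (real k + 1) * (K ^ card {p \<in> P. p dvd m} * real m powr e)"
        using IH by (intro mult_left_mono) auto
      also have "\<dots> \<le> K ^ card {p \<in> P. p dvd n} * (real p powr (real k * e)) * real m powr e"
        using mult_right_mono[OF step, of "real m powr e"] by (simp add: mult.assoc)
      also have "\<dots> = K ^ card {p \<in> P. p dvd n} * real n powr e"
        using m m0 p(1) prime_gt_0_nat[of p]
        by (simp add: powr_mult powr_powr flip: powr_realpow)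
      finally show ?thesis .
    qed
  qed
  show ?thesis
  proof
    show "K ^ card P > 0" using K by simp
    fix n :: nat assume n: "n > 0"
    have "K ^ card {p \<in> P. p dvd n} \<le> K ^ card P"
      using K finP by (intro power_increasing card_mono) auto
    then have "K ^ card {p \<in> P. p dvd n} * real n powr e \<le> K ^ card P * real n powr e"
      by (intro mult_right_mono) auto
    with main[OF n] show "real (card {d. d dvd n}) \<le> K ^ card P * real n powr e" by linarith
  qed
qed

section \<open>Classes of solutions\<close>

text \<open>Multiplied by \<open>K\<close>, the quotient of the two solutions is
  \<open>u + v * sqrt D\<close> with integers \<open>u\<close>, \<open>v\<close> and norm
  \<open>K^2\<close>. It exceeds \<open>K\<close>, so its conjugate lies strictly between 0 and
  \<open>K\<close>; hence \<open>v \<ge> 1\<close>, and then \<open>u \<ge> K\<close> by the norm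
  equation.\<close>

lemma norm_one_ratio_ge:
  fixes x m x' m' D N K :: int
  assumes D: "D > 0" and K: "K > 0" and N: "N \<noteq> 0"
    and eq: "x^2 - D * m^2 = N" and eq': "x'^2 - D * m'^2 = N"
    and dvd: "N dvd K * (x * m' - x' * m)"
    and pos: "0 < x' + m' * sqrt D" and less: "x' + m' * sqrt D < x + m * sqrt D"
  shows "(1 + sqrt D / K) * (x' + m' * sqrt D) \<le> x + m * sqrt D"
proof -
  define s where "s = sqrt (real_of_int D)"
  define A where "A = x * x' - D * m * m'"
  define B where "B = m * x' - x * m'"
  have s: "s > 0" "s * s = D" using D by (auto simp: s_def)
  have AB: "A^2 - D * B^2 = N^2"
  proof -
    have "A^2 - D * B^2 = (x^2 - D * m^2) * (x'^2 - D * m'^2)"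
      unfolding A_def B_def by algebra
    then show ?thesis unfolding eq eq' by (simp only: power2_eq_square)
  qed
  have "K * B = - (K * (x * m' - x' * m))" by (simp add: B_def algebra_simps)
  with dvd have "N dvd K * B" by simp
  then obtain v where v: "K * B = N * v" by (elim dvdE)
  \<comment> \<open>Divisibility is assumed for the coefficient \<open>B\<close> of the quotient
    only; the norm identity transfers it to \<open>A\<close>, since \<open>N^2\<close> divides
    \<open>(K * A)^2\<close>.\<close>
  have sq: "(K * A)^2 = N^2 * (K^2 + D * v^2)"
  proof -
    have "(K * A)^2 = K^2 * (N^2 + D * B^2)" using AB by (simp add: power_mult_distrib)
    also have "\<dots> = K^2 * N^2 + D * (K * B)^2" by algebra
    also have "\<dots> = N^2 * (K^2 + D * v^2)" unfolding v by algebra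
    finally show ?thesis .
  qed
  then have "N^2 dvd (K * A)^2" by simp
  then have "N dvd K * A" by simp
  then obtain u where u: "K * A = N * u" by (elim dvdE)
  have uv: "u^2 - D * v^2 = K^2" using sq N unfolding u by (simp add: power_mult_distrib)
  define a where "a = x + m * s"
  define a' where "a' = x' + m' * s"
  have a': "a' > 0" "a' < a" using pos less by (auto simp: a_def a'_def s_def)
  have "real_of_int N = a' * (x' - m' * s)"
  proof -
    have "real_of_int N = real_of_int (x'^2 - D * m'^2)" by (simp only: eq')
    moreover have "a' * (x' - m' * s) = real_of_int x'^2 - (s * s) * real_of_int m'^2"
      unfolding a'_def by algebra
    ultimately show ?thesis by (simp add: s(2))
  qed
  have "real_of_int N * (u + v * s) = K * A + K * B * s"
  proof -
    have "real_of_int N * (u + v * s) = real_of_int (N * u) + real_of_int (N * v) * s"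
      by (simp add: algebra_simps)
    then show ?thesis by (simp flip: u v)
  qed
  also have "\<dots> = K * (a * (x' - m' * s))"
    using s(2) by (simp add: A_def B_def a_def algebra_simps)
  finally have "N * (u + v * s) * a' = K * (a * (a' * (x' - m' * s)))" by simp
  then have "N * (u + v * s) * a' = K * (a * N)"
    by (simp add: \<open>real_of_int N = a' * (x' - m' * s)\<close>)
  then have ratio: "(u + v * s) * a' = K * a" using N by simp
  then have gt: "u + v * s > K"
  proof -
    have "K * a' < (u + v * s) * a'" using ratio a' K by simp
    then show ?thesis using a' by simp
  qed
  have prod: "(u + v * s) * (u - v * s) = real_of_int K^2"
  proof -
    have "(u + v * s) * (u - v * s) = real_of_int (u^2 - D * v^2)"
      using s(2) by (simp add: power2_eq_square algebra_simps)
    then show ?thesis by (simp add: uv)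
  qed
  have kp: "real_of_int K > 0" using K by simp
  have p1: "u - v * s > 0"
  proof -
    have "0 < (u + v * s) * (u - v * s)" using prod kp by simp
    moreover have "0 < u + v * s" using gt kp by linarith
    ultimately show ?thesis by (rule zero_less_mult_pos)
  qed
  have p2: "u - v * s < K"
  proof (rule ccontr)
    assume "\<not> ?thesis"
    then have "K * K < (u + v * s) * (u - v * s)" using gt kp unfolding of_int_mult by (intro mult_less_le_imp_less) auto
    then show False using prod by (simp add: power2_eq_square)
  qed
  have "v * s > 0" using gt p2 by linarith
  then have "v > 0" using s by (simp add: zero_less_mult_iff)
  then have "v * s \<ge> s" using s by simp
  have "real_of_int u > 0" using gt p1 kp by linarith
  then have "u \<ge> K"
  proof -
    have "K^2 \<le> u^2" using uv D by (smt (verit) mult_nonneg_nonneg zero_le_power2)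
    then show ?thesis using \<open>real_of_int u > 0\<close> by (simp add: power2_le_iff_abs_le)
  qed
  then have "K + s \<le> u + v * s" using \<open>v * s \<ge> s\<close> by linarith
  then have "(K + s) * a' \<le> K * a" using a' by (simp flip: ratio)
  then have "(1 + s / K) * a' \<le> a" using kp by (simp add: field_simps)
  then show ?thesis by (simp add: a_def a'_def s_def)
qed

text \<open>Both solutions have norm \<open>N\<close>, so
  \<open>(x * m0 - x0 * m) * (x * m0 + x0 * m) = N * (m0^2 - m^2)\<close>. The part of
  \<open>N\<close> not absorbed by the first factor must divide the second.\<close>

lemma dvd_complementary_divisor:
  fixes x m x0 m0 D N :: int
  assumes N: "N \<noteq> 0" and eq: "x^2 - D * m^2 = N" and eq0: "x0^2 - D * m0^2 = N"
    and d: "d = gcd (x * m0 - x0 * m) N"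
  shows "N div d dvd x * m0 + x0 * m"
proof -
  have "(x * m0 - x0 * m) * (x * m0 + x0 * m) = N * (m0^2 - m^2)"
  proof -
    have "x^2 = N + D * m^2" "x0^2 = N + D * m0^2" using eq eq0 by simp_all
    moreover have "(x * m0 - x0 * m) * (x * m0 + x0 * m) = x^2 * m0^2 - x0^2 * m^2" by algebra
    ultimately show ?thesis by (simp add: algebra_simps)
  qed
  then have "N dvd (x * m0 - x0 * m) * (x * m0 + x0 * m)" by simp
  moreover have d0: "d \<noteq> 0" "d dvd N" "d dvd x * m0 - x0 * m" using N d by auto
  ultimately have "N div d dvd ((x * m0 - x0 * m) div d) * (x * m0 + x0 * m)"
    by (metis div_dvd_div div_mult_swap dvd_mult2 mult.commute)
  moreover have "coprime ((x * m0 - x0 * m) div d) (N div d)"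
    unfolding d using N by (intro div_gcd_coprime) auto
  ultimately show ?thesis by (simp add: coprime_commute coprime_dvd_mult_right_iff)
qed

lemma coprime_root_norm:
  fixes x m D N :: int
  assumes "x^2 - D * m^2 = N" "coprime x m"
  shows "coprime m N"
proof -
  have "x^2 = N + m * (D * m)" using assms(1) by (simp add: power2_eq_square algebra_simps)
  then have "c dvd x^2" if "c dvd m" "c dvd N" for c using that by simp
  moreover have "coprime m (x^2)" using assms(2) by (simp add: coprime_commute)
  ultimately show ?thesis by (meson coprimeI coprime_common_divisor)
qed

text \<open>The class of a primitive solution is \<open>d = gcd (x * m0 - x0 * m) N\<close> relative to a reference
  solution \<open>(x0, m0)\<close>. It fixes \<open>x / m\<close> modulo \<open>d\<close> and modulo \<open>N div d\<close>, hence modulo \<open>N\<close> up to the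
  common part \<open>g\<close> of these divisors, and primitivity forces \<open>g^2 dvd 4 * D\<close>.\<close>

lemma primitive_same_class_dvd:
  fixes x m x' m' x0 m0 D N :: int
  assumes N: "N \<noteq> 0"
    and eq: "x^2 - D * m^2 = N" "coprime x m"
    and eq': "x'^2 - D * m'^2 = N"
    and eq0: "x0^2 - D * m0^2 = N" "coprime x0 m0"
    and same: "gcd (x * m0 - x0 * m) N = gcd (x' * m0 - x0 * m') N"
  shows "N dvd 4 * D * (x * m' - x' * m)"
proof -
  define d where "d = gcd (x * m0 - x0 * m) N"
  define e where "e = N div d"
  define z where "z = x * m' - x' * m"
  have N_de: "N = d * e" by (simp add: d_def e_def)
  have de0: "d \<noteq> 0" "e \<noteq> 0" using N N_de by auto
  have cop0: "coprime m0 N" and cop: "coprime m N"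
    using coprime_root_norm[OF eq] coprime_root_norm[OF eq0] by auto
  have d1: "d dvd x * m0 - x0 * m" "d dvd x' * m0 - x0 * m'"
    by (simp_all add: d_def) (simp add: same)
  have e1: "e dvd x * m0 + x0 * m" "e dvd x' * m0 + x0 * m'"
    using dvd_complementary_divisor[OF N eq(1) eq0(1)] dvd_complementary_divisor[OF N eq' eq0(1)] same
    by (auto simp: e_def d_def)
  have "d dvd m' * (x * m0 - x0 * m) - m * (x' * m0 - x0 * m')"
    using d1 by (intro dvd_diff) auto
  then have "d dvd m0 * z" by (simp add: z_def algebra_simps)
  then have dz: "d dvd z"
    using cop0 N_de by (metis coprime_commute coprime_dvd_mult_right_iff coprime_mult_left_iff)
  have "e dvd m' * (x * m0 + x0 * m) - m * (x' * m0 + x0 * m')"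
    using e1 by (intro dvd_diff) auto
  then have "e dvd m0 * z" by (simp add: z_def algebra_simps)
  then have ez: "e dvd z"
    using cop0 N_de by (metis coprime_commute coprime_dvd_mult_right_iff coprime_mult_left_iff)
  define g where "g = gcd d e"
  have "lcm d e dvd z" using dz ez by simp
  then have "g * lcm d e dvd g * z" by simp
  moreover have "N dvd g * lcm d e" by (simp add: g_def N_de flip: abs_mult)
  ultimately have Ngz: "N dvd g * z" by (rule dvd_trans[rotated])
  have g: "g dvd d" "g dvd e" by (auto simp: g_def)
  then have ggN: "g * g dvd N" using N_de by (simp add: mult_dvd_mono)
  \<comment> \<open>\<open>g\<close> divides both \<open>x * m0 - x0 * m\<close> and
    \<open>x * m0 + x0 * m\<close>, hence their sum \<open>2 * x * m0\<close>, hence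
    \<open>2 * x\<close>. Then \<open>g^2\<close> divides
    \<open>4 * x^2 - 4 * N = 4 * D * m^2\<close>, where \<open>m\<close> is coprime to
    \<open>g\<close>.\<close>
  have "g dvd (x * m0 - x0 * m) + (x * m0 + x0 * m)"
    by (intro dvd_add dvd_trans[OF g(1) d1(1)] dvd_trans[OF g(2) e1(1)])
  then have gx: "g dvd m0 * (2 * x)" by (simp add: algebra_simps)
  have gN: "g dvd N" using ggN by (rule dvd_mult_left)
  have "coprime g m0" "coprime g m"
    using coprime_divisors[OF dvd_refl gN cop] coprime_divisors[OF dvd_refl gN cop0]
    by (simp_all only: coprime_commute)
  then have "g dvd 2 * x" using gx by (simp only: coprime_dvd_mult_right_iff)
  then have "g * g dvd (2 * x) * (2 * x)" by (intro mult_dvd_mono)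
  then have "g * g dvd (2 * x) * (2 * x) - 4 * N" using ggN by (intro dvd_diff) auto
  moreover have "(2 * x) * (2 * x) - 4 * N = (4 * D) * (m * m)"
    using eq(1) by (simp add: power2_eq_square algebra_simps)
  ultimately have "g * g dvd (4 * D) * (m * m)" by simp
  moreover have "coprime (g * g) (m * m)" using \<open>coprime g m\<close> by simp
  ultimately have "g * g dvd 4 * D" by (simp only: coprime_dvd_mult_left_iff)
  then have "g dvd 4 * D" by (rule dvd_mult_left)
  then have "g * z dvd 4 * D * z" by simp
  with Ngz show ?thesis unfolding z_def by (rule dvd_trans)
qed

text \<open>A solution with gcd \<open>g\<close> is divided by \<open>g\<close>, which turns
  \<open>N\<close> into \<open>N div g^2\<close>. The invariant is \<open>g\<close> together with
  the class of the primitive quotient, and both are divisors of \<open>N\<close>.\<close>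

lemma ex_class_invariant:
  fixes D N :: int
  assumes N: "N \<noteq> 0"
  obtains \<Phi> :: "int \<times> int \<Rightarrow> nat \<times> nat" where
    "\<And>x m. x^2 - D * m^2 = N \<Longrightarrow> \<Phi> (x, m) \<in> {d. d dvd nat \<bar>N\<bar>} \<times> {d. d dvd nat \<bar>N\<bar>}"
    "\<And>x m x' m'. \<lbrakk>x^2 - D * m^2 = N; x'^2 - D * m'^2 = N; \<Phi> (x, m) = \<Phi> (x', m')\<rbrakk>
       \<Longrightarrow> N dvd 4 * D * (x * m' - x' * m)"
proof -
  define prim where "prim g z \<longleftrightarrow> (case z of (x, m) \<Rightarrow>
    coprime x m \<and> x^2 - D * m^2 = N div g^2)" for g :: int and z :: "int \<times> int"
  \<comment> \<open>The choice is meaningful only if some primitive solution of norm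
    \<open>N div g^2\<close> exists; \<open>basic\<close> supplies one whenever \<open>g\<close> is
    the gcd of an actual solution.\<close>
  define ref where "ref g = (SOME z. prim g z)" for g
  define cl where "cl = (\<lambda>(x, m). let g = gcd x m; (x0, m0) = ref g in
     gcd ((x div g) * m0 - x0 * (m div g)) (N div g^2))"
  define \<Phi> where "\<Phi> = (\<lambda>(x, m). (nat (gcd x m), nat (cl (x, m))))"
  have basic: "gcd x m > 0" "N = (gcd x m)^2 * (N div (gcd x m)^2)"
    "prim (gcd x m) (x div gcd x m, m div gcd x m)" "prim (gcd x m) (ref (gcd x m))"
    if eq: "x^2 - D * m^2 = N" for x m
  proof -
    define g where "g = gcd x m"
    show g0: "gcd x m > 0" using N eq by (auto simp: gcd_pos_int)
    have x: "x = g * (x div g)" and m: "m = g * (m div g)" by (simp_all add: g_def)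
    have N': "N = g^2 * ((x div g)^2 - D * (m div g)^2)"
    proof -
      have "N = (g * (x div g))^2 - D * (g * (m div g))^2" using eq x m by simp
      then show ?thesis by (simp add: algebra_simps power_mult_distrib)
    qed
    then have "g^2 dvd N" by (metis dvd_triv_left)
    then show "N = (gcd x m)^2 * (N div (gcd x m)^2)" by (simp add: g_def)
    show prim: "prim (gcd x m) (x div gcd x m, m div gcd x m)"
      using g0 N' N unfolding prim_def g_def[symmetric]
      by (auto simp: g_def intro!: div_gcd_coprime)
    show "prim (gcd x m) (ref (gcd x m))" unfolding ref_def using prim by (rule someI)
  qed
  have cl: "cl (x, m) > 0" "cl (x, m) dvd N" if "x^2 - D * m^2 = N" for x m
  proof -
    define g where "g = gcd x m"
    obtain x0 m0 where r: "ref g = (x0, m0)" by fastforce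
    have c: "cl (x, m) = gcd ((x div g) * m0 - x0 * (m div g)) (N div g^2)"
      by (simp add: cl_def r Let_def flip: g_def)
    have b: "N = g^2 * (N div g^2)" using basic(2)[OF that] by (simp add: g_def)
    then have "N div g^2 \<noteq> 0" using N by auto
    then show "cl (x, m) > 0" unfolding c by simp
    have "cl (x, m) dvd N div g^2" unfolding c by simp
    then show "cl (x, m) dvd N" using b by (metis dvd_mult)
  qed
  show ?thesis
  proof
    fix x m assume eq: "x^2 - D * m^2 = N"
    have "gcd x m dvd N" using basic(2)[OF eq] by (metis dvd_mult2 dvd_triv_left power2_eq_square)
    then show "\<Phi> (x, m) \<in> {d. d dvd nat \<bar>N\<bar>} \<times> {d. d dvd nat \<bar>N\<bar>}"
      using cl[OF eq] by (auto simp: \<Phi>_def nat_dvd_iff nat_abs_dvd_iff)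
  next
    fix x m x' m' assume eq: "x^2 - D * m^2 = N" and eq': "x'^2 - D * m'^2 = N"
      and same: "\<Phi> (x, m) = \<Phi> (x', m')"
    define g where "g = gcd x m"
    have g': "gcd x' m' = g"
      using same eq_nat_nat_iff[of "gcd x m" "gcd x' m'"] by (simp add: \<Phi>_def g_def)
    have cls: "cl (x, m) = cl (x', m')"
      using same cl(1)[OF eq] cl(1)[OF eq'] eq_nat_nat_iff[of "cl (x, m)" "cl (x', m')"]
      by (simp add: \<Phi>_def)
    obtain x0 m0 where r: "ref g = (x0, m0)" by fastforce
    define y n y' n' where "y = x div g" and "n = m div g" and "y' = x' div g" and "n' = m' div g"
    have g0: "g > 0" and Ng: "N = g^2 * (N div g^2)"
      using basic(1,2)[OF eq] by (auto simp: g_def)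
    have "prim g (y, n)" "prim g (y', n')" "prim g (x0, m0)"
      using basic(3,4)[OF eq] basic(3)[OF eq'] g' r by (auto simp: g_def y_def n_def y'_def n'_def)
    moreover have "gcd (y * m0 - x0 * n) (N div g^2) = gcd (y' * m0 - x0 * n') (N div g^2)"
      using cls r by (simp add: cl_def Let_def g' y_def n_def y'_def n'_def flip: g_def)
    moreover have "N div g^2 \<noteq> 0" using N Ng by auto
    ultimately have "N div g^2 dvd 4 * D * (y * n' - y' * n)"
      by (intro primitive_same_class_dvd[of _ _ _ _ _ _ x0 m0]) (auto simp: prim_def)
    then have dvd: "g^2 * (N div g^2) dvd g^2 * (4 * D * (y * n' - y' * n))" by simp
    have "x = g * y" "m = g * n" by (simp_all add: y_def n_def g_def)
    moreover have "x' = g * y'" "m' = g * n'" by (simp_all add: y'_def n'_def flip: g')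
    \<comment> \<open>The determinant is quadratic, so restoring \<open>g\<close> multiplies it by
      \<open>g^2\<close>, exactly the factor missing from \<open>N div g^2\<close>.\<close>
    ultimately have "g^2 * (4 * D * (y * n' - y' * n)) = 4 * D * (x * m' - x' * m)"
      by (simp add: power2_eq_square algebra_simps)
    then show "N dvd 4 * D * (x * m' - x' * m)" using dvd Ng by metis
  qed
qed

section \<open>Weighted sums over solutions\<close>

lemma power_powr:
  fixes a t :: real
  shows "a > 0 \<Longrightarrow> (a ^ n) powr t = a powr (real n * t)"
  by (simp add: powr_powr flip: powr_realpow)

lemma nonsquare_imp_no_zero:
  fixes D x m :: int
  assumes "\<not> (\<exists>k::int. D = k^2)" "m \<noteq> 0"
  shows "x^2 - D * m^2 \<noteq> 0"
proof
  assume "x^2 - D * m^2 = 0"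
  then have eq: "x^2 = D * m^2" by simp
  then have "m^2 dvd x^2" by simp
  then obtain k where "x = m * k" by (auto elim: dvdE)
  with eq assms(2) have "D = k^2" by (simp add: power_mult_distrib)
  with assms(1) show False by blast
qed

text \<open>Two solutions with small \<open>m\<close> would have \<open>x'^2 - x^2\<close> exceeding \<open>D * (m'^2 - m^2)\<close>.\<close>

lemma card_small_solutions:
  fixes D N :: int
  assumes D: "D > 0" and F: "finite F"
    and sol: "\<And>x m. (x, m) \<in> F \<Longrightarrow> x \<ge> 0 \<and> m \<ge> 1 \<and> x^2 - D * m^2 = N \<and> D^2 * m^4 < \<bar>N\<bar>"
  shows "card F \<le> 1"
proof -
  have aux: False
    if "(x, m) \<in> F" "(x', m') \<in> F" "m < m'" for x m x' m'
  proof -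
    note a = sol[OF that(1)] and a' = sol[OF that(2)]
    have "m^2 < m'^2" using a that by (intro power_strict_mono) auto
    then have "D * m^2 < D * m'^2" using D by simp
    then have "x^2 < x'^2" using a a' by linarith
    then have "x < x'" using a' power2_less_imp_less by blast
    have m1: "m'^2 \<ge> 1" using a' by simp
    have Dm: "(D * m'^2)^2 = D^2 * m'^4" by (simp add: power_mult_distrib flip: power_mult)
    \<comment> \<open>A negative \<open>N\<close> satisfies
      \<open>\<bar>N\<bar> \<le> D * m'^2\<close>, which is too small for the assumption on
      \<open>m'\<close>.\<close>
    have Npos: "N > 0"
    proof (rule ccontr)
      assume "\<not> N > 0"
      then have "\<bar>N\<bar> \<le> D * m'^2" using a' by (smt (verit) zero_le_power2)
      also have "\<dots> \<le> (D * m'^2)^2"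
      proof -
        have "0 < D * m'^2" using D m1 by (intro mult_pos_pos) auto
        then show ?thesis using self_le_power[of "D * m'^2" 2] by simp
      qed
      finally show False using a' Dm by linarith
    qed
    \<comment> \<open>Now \<open>x\<close> exceeds \<open>D * m'^2\<close>, so already the gap
      \<open>2 * x + 1\<close> to the next square is larger than
      \<open>D * (m'^2 - m^2)\<close>.\<close>
    have "(D * m'^2)^2 < N" using a' Dm Npos by linarith
    also have "N \<le> x^2" using a D by (smt (verit) mult_nonneg_nonneg zero_le_power2)
    finally have "D * m'^2 < x" using a power2_less_imp_less by blast
    have "(x + 1)^2 \<le> x'^2" using \<open>x < x'\<close> a by (intro power_mono) auto
    then have "2 * x + 1 \<le> D * m'^2 - D * m^2" using a a' by (simp add: power2_eq_square algebra_simps)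
    moreover have "D * m^2 \<ge> 0" using D by simp
    ultimately show False using \<open>D * m'^2 < x\<close> a by linarith
  qed
  have "z = z'" if "z \<in> F" "z' \<in> F" for z z'
  proof -
    obtain x m x' m' where z: "z = (x, m)" "z' = (x', m')" by fastforce
    then have "m = m'" using aux[of x m x' m'] aux[of x' m' x m] that
      by (cases m m' rule: linorder_cases) auto
    moreover have "x^2 - D * m^2 = N" "x'^2 - D * m'^2 = N" using sol z that by auto
    ultimately have "m = m'" "x^2 = x'^2" by simp_all
    from \<open>x^2 = x'^2\<close> have "x = x'" by (rule power2_eq_imp_eq) (use sol z that in auto)
    then show ?thesis using z \<open>m = m'\<close> by simp
  qed
  then show ?thesis using F by (metis card_le_Suc0_iff_eq One_nat_def)
qed

text \<open>Every solution is determined by its class and by the integer part of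
  \<open>log \<rho> (x + m * sqrt D)\<close>; when \<open>m\<close> is large compared with \<open>N\<close>, both
  \<open>\<bar>N\<bar>\<close> and \<open>x + m * sqrt D\<close> are bounded by powers of \<open>m\<close>, so the weight beats the
  divisor bound for the number of classes and makes the sum over the logarithm geometric.\<close>

lemma sum_large_solutions_bounded:
  fixes D :: int and lam :: real
  assumes D: "D > 0" and lam: "lam > 0"
  obtains C where "C \<ge> 0" "\<And>N F. \<lbrakk>N \<noteq> 0; finite F;
      \<And>x m. (x, m) \<in> F \<Longrightarrow> x \<ge> 0 \<and> m \<ge> 1 \<and> x^2 - D * m^2 = N \<and> \<bar>N\<bar> \<le> D^2 * m^4\<rbrakk>
      \<Longrightarrow> (\<Sum>(x, m)\<in>F. real_of_int m powr (- lam)) \<le> C"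
proof -
  \<comment> \<open>The gap of \<open>norm_one_ratio_ge\<close> for \<open>K = 4 * D\<close>, the
    denominator that the class invariant permits.\<close>
  define \<rho> where "\<rho> = 1 + sqrt D / (4 * D)"
  have sD: "sqrt D > 0" using D by simp
  then have \<rho>: "\<rho> > 1" using D by (simp add: \<rho>_def)
  \<comment> \<open>Budget of exponents: a pair of divisors costs
    \<open>\<bar>N\<bar> powr (lam / 8)\<close>, which one half of the weight,
    \<open>m powr (- (lam / 2))\<close>, repays because
    \<open>\<bar>N\<bar> \<le> D^2 * m^4\<close>. The other half turns into \<open>q ^ L\<close>
    because \<open>x + m * sqrt D \<le> 3 * D * m^2\<close>.\<close>
  obtain T where T: "T > 0" "\<And>n::nat. n > 0 \<Longrightarrow> real (card {d. d dvd n}) \<le> T * real n powr (lam / 16)"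
    using card_divisors_le_powr[of "lam / 16"] lam by auto
  define q where "q = \<rho> powr (- (lam / 4))"
  have q: "0 < q" "q < 1" using \<rho> lam by (auto simp: q_def powr_less_one)
  define c1 where "c1 = (real_of_int D^2) powr (lam / 8)"
  define c2 where "c2 = (3 * real_of_int D) powr (lam / 4)"
  have c: "c1 > 0" "c2 > 0" using D by (auto simp: c1_def c2_def)
  define C where "C = c1 * c2 * T^2 * (1 / (1 - q))"
  show ?thesis
  proof
    show "C \<ge> 0" using c q T by (simp add: C_def)
  next
    fix N F assume N: "N \<noteq> 0" and F: "finite F" and
      sol: "\<And>x m. (x, m) \<in> F \<Longrightarrow> x \<ge> 0 \<and> m \<ge> 1 \<and> x^2 - D * m^2 = N \<and> \<bar>N\<bar> \<le> D^2 * m^4"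
    define Dv where "Dv = {d. d dvd nat \<bar>N\<bar>}"
    have finDv: "finite Dv" unfolding Dv_def using N by (intro finite_divisors_nat) simp
    obtain \<Phi> :: "int \<times> int \<Rightarrow> nat \<times> nat" where \<Phi>:
      "\<And>x m. x^2 - D * m^2 = N \<Longrightarrow> \<Phi> (x, m) \<in> Dv \<times> Dv"
      "\<And>x m x' m'. \<lbrakk>x^2 - D * m^2 = N; x'^2 - D * m'^2 = N; \<Phi> (x, m) = \<Phi> (x', m')\<rbrakk>
         \<Longrightarrow> N dvd 4 * D * (x * m' - x' * m)"
      using ex_class_invariant[OF N] unfolding Dv_def by blast
    define val where "val = (\<lambda>(x::int, m::int). x + m * sqrt D)"
    define L where "L z = nat \<lfloor>log \<rho> (val z)\<rfloor>" for z
    have val1: "val z \<ge> 1" if "z \<in> F" for z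
    proof -
      obtain x m where z: "z = (x, m)" by fastforce
      have "1 * 1 \<le> real_of_int m * sqrt D"
        using sol[of x m] that z D by (intro mult_mono) auto
      then show ?thesis using sol[of x m] that z by (simp add: val_def)
    qed
    have Lle: "real (L z) \<le> log \<rho> (val z)" and Lgt: "log \<rho> (val z) < real (L z) + 1"
      if "z \<in> F" for z
    proof -
      have "log \<rho> (val z) \<ge> 0" using val1[OF that] \<rho> by simp
      then show "real (L z) \<le> log \<rho> (val z)" "log \<rho> (val z) < real (L z) + 1"
        by (simp_all add: L_def)
    qed
    have inj: "inj_on (\<lambda>z. (\<Phi> z, L z)) F"
    proof -
      have neq: False
        if zF: "z \<in> F" "z' \<in> F" and same: "\<Phi> z = \<Phi> z'" "L z = L z'" and lt: "val z' < val z" for z z'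
      proof -
        obtain x m x' m' where z: "z = (x, m)" "z' = (x', m')" by fastforce
        have "(1 + sqrt D / (4 * D)) * val z' \<le> val z"
          using norm_one_ratio_ge[of D "4 * D" N x m x' m'] D N sol zF z \<Phi>(2)[of x m x' m'] same lt
            val1[OF zF(2)] by (simp add: val_def)
        then have "\<rho> * val z' \<le> val z" by (simp add: \<rho>_def)
        then have "log \<rho> (\<rho> * val z') \<le> log \<rho> (val z)"
          using \<rho> val1[OF zF(2)] by (intro log_mono) auto
        then have "log \<rho> (val z') + 1 \<le> log \<rho> (val z)"
          using \<rho> val1[OF zF(2)] by (simp add: log_mult)
        then show False using Lle[OF zF(2)] Lgt[OF zF(1)] same by simp
      qed
      show ?thesis
      proof (rule inj_onI)
        fix z z' assume zF: "z \<in> F" "z' \<in> F" and "(\<Phi> z, L z) = (\<Phi> z', L z')"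
        then have same: "\<Phi> z = \<Phi> z'" "L z = L z'" by auto
        have veq: "val z = val z'" using neq[OF zF same] neq[OF zF(2,1)] same by force
        obtain x m x' m' where z: "z = (x, m)" "z' = (x', m')" by fastforce
        \<comment> \<open>For fixed \<open>N\<close> a larger \<open>m\<close> forces a larger
          \<open>x\<close>, so \<open>val\<close> separates the solutions.\<close>
        have less: False if "(x, m) \<in> F" "(x', m') \<in> F" "val (x, m) = val (x', m')" "m < m'"
          for x m x' m'
        proof -
          have "x^2 - x'^2 = D * m^2 - D * m'^2" using sol[OF that(1)] sol[OF that(2)] by linarith
          moreover have "m^2 < m'^2" using sol[OF that(1)] that by (intro power_strict_mono) auto
          ultimately have "x^2 < x'^2" using D by (smt (verit) mult_less_cancel_left_pos)
          then have "x < x'" using sol[OF that(2)] power2_less_imp_less by blast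
          moreover have "m * sqrt D < m' * sqrt D" using sD that by simp
          ultimately show False using that by (simp add: val_def)
        qed
        have "m = m'" using less[of x m x' m'] less[of x' m' x m] zF z veq by fastforce
        then show "z = z'" using veq z by (simp add: val_def)
      qed
    qed
    define w where "w = c1 * c2 * real (nat \<bar>N\<bar>) powr (- (lam / 8))"
    have w0: "w \<ge> 0" using c by (simp add: w_def)
    have trm: "real_of_int m powr (- lam) \<le> w * q ^ L (x, m)" if "(x, m) \<in> F" for x m
    proof -
      note s = sol[OF that]
      have m1: "real_of_int m \<ge> 1" using s by simp
      have D1: "real_of_int D \<ge> 1" using D by simp
      have N_le: "real (nat \<bar>N\<bar>) \<le> (real_of_int D)^2 * real_of_int m ^ 4"
      proof -
        have "real_of_int \<bar>N\<bar> \<le> real_of_int (D^2 * m^4)" using s by (subst of_int_le_iff) auto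
        then show ?thesis by simp
      qed
      have A: "real_of_int m powr (- (lam / 2)) \<le> c1 * real (nat \<bar>N\<bar>) powr (- (lam / 8))"
      proof -
        have "((real_of_int D)^2 * real_of_int m ^ 4) powr (- (lam / 8)) \<le> real (nat \<bar>N\<bar>) powr (- (lam / 8))"
          using N N_le lam by (intro powr_mono2') auto
        moreover have "((real_of_int D)^2 * real_of_int m ^ 4) powr (- (lam / 8))
            = real_of_int m powr (- (lam / 2)) / c1"
        proof -
          have "(real_of_int m ^ 4) powr (- (lam / 8)) = real_of_int m powr (- (lam / 2))"
            using power_powr[of "real_of_int m" 4 "- (lam / 8)"] m1 by simp
          moreover have "(real_of_int D ^ 2) powr (- (lam / 8)) = 1 / c1"
            unfolding c1_def by (rule powr_minus_divide)
          ultimately show ?thesis by (simp only: powr_mult) simp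
        qed
        ultimately have "real_of_int m powr (- (lam / 2)) / c1 \<le> real (nat \<bar>N\<bar>) powr (- (lam / 8))" by simp
        then show ?thesis using c by (simp add: pos_divide_le_eq mult.commute)
      qed
      have B: "real_of_int m powr (- (lam / 2)) \<le> c2 * q ^ L (x, m)"
      proof -
        have m2: "real_of_int m \<le> real_of_int m ^ 2" using m1 by (simp add: self_le_power)
        have "x^2 \<le> (2 * D * m^2)^2"
        proof -
          have "D * m^2 \<le> (D * m^2)^2"
          proof -
            have "0 < D * m^2" using D s by (intro mult_pos_pos) auto
            then show ?thesis using self_le_power[of "D * m^2" 2] by simp
          qed
          moreover have "x^2 \<le> D^2 * m^4 + D * m^2" using s by linarith
          moreover have "(2 * D * m^2)^2 = 4 * (D * m^2)^2" "D^2 * m^4 = (D * m^2)^2"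
            by (simp_all add: power_mult_distrib flip: power_mult)
          ultimately show ?thesis using zero_le_power2[of "D * m^2"] by linarith
        qed
        then have "x \<le> 2 * D * m^2" by (rule power2_le_imp_le) (use D in simp)
        then have x: "real_of_int x \<le> 2 * D * real_of_int m^2"
        proof -
          have "real_of_int x \<le> real_of_int (2 * D * m^2)"
            using \<open>x \<le> 2 * D * m^2\<close> by (subst of_int_le_iff)
          then show ?thesis by simp
        qed
        have "sqrt D \<le> D" using D1 by (intro real_le_lsqrt) (auto simp: self_le_power)
        then have "m * sqrt D \<le> real_of_int m^2 * D"
          using m1 m2 sD by (intro mult_mono) auto
        then have v: "val (x, m) \<le> 3 * D * real_of_int m^2" using x by (simp add: val_def mult_ac)
        have "\<rho> powr (real (L (x, m))) \<le> val (x, m)"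
        proof -
          have "\<rho> powr (real (L (x, m))) \<le> \<rho> powr (log \<rho> (val (x, m)))"
            using Lle[OF that] \<rho> by (intro powr_mono) auto
          then show ?thesis using val1[OF that] \<rho> by simp
        qed
        then have "\<rho> powr (real (L (x, m))) \<le> 3 * D * real_of_int m^2" using v by linarith
        then have "(3 * D * real_of_int m^2) powr (- (lam / 4)) \<le> (\<rho> powr real (L (x, m))) powr (- (lam / 4))"
          using \<rho> lam by (intro powr_mono2') auto
        moreover have "(\<rho> powr real (L (x, m))) powr (- (lam / 4)) = q ^ L (x, m)"
          using \<rho> q by (simp add: q_def powr_powr mult.commute flip: powr_realpow)
        moreover have "(3 * D * real_of_int m^2) powr (- (lam / 4)) = real_of_int m powr (- (lam / 2)) / c2"
        proof -
          have "(real_of_int m ^ 2) powr (- (lam / 4)) = real_of_int m powr (- (lam / 2))"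
            using power_powr[of "real_of_int m" 2 "- (lam / 4)"] m1 by simp
          moreover have "(3 * real_of_int D) powr (- (lam / 4)) = 1 / c2"
            unfolding c2_def by (rule powr_minus_divide)
          ultimately show ?thesis
            using powr_mult[of "3 * real_of_int D" "real_of_int m ^ 2" "- (lam / 4)"] by simp
        qed
        ultimately have "real_of_int m powr (- (lam / 2)) / c2 \<le> q ^ L (x, m)" by simp
        then show ?thesis using c by (simp add: pos_divide_le_eq mult.commute)
      qed
      have "real_of_int m powr (- lam) = real_of_int m powr (- (lam / 2)) * real_of_int m powr (- (lam / 2))"
        by (simp flip: powr_add)
      also have "\<dots> \<le> (c1 * real (nat \<bar>N\<bar>) powr (- (lam / 8))) * (c2 * q ^ L (x, m))"
        using A B c by (intro mult_mono) auto
      finally show ?thesis by (simp add: w_def mult_ac)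
    qed
    \<comment> \<open>The inserted 0 covers empty \<open>F\<close>. The size of \<open>M\<close> is
      immaterial, since the geometric sum below \<open>M\<close> is bounded by the full
      series.\<close>
    define M where "M = Suc (Max (insert 0 (L ` F)))"
    have LM: "L z < M" if "z \<in> F" for z
      using that F by (auto simp: M_def less_Suc_eq_le intro!: Max_ge)
    have img: "(\<lambda>z. (\<Phi> z, L z)) ` F \<subseteq> (Dv \<times> Dv) \<times> {..<M}"
    proof
      fix y assume "y \<in> (\<lambda>z. (\<Phi> z, L z)) ` F"
      then obtain x m where "(x, m) \<in> F" "y = (\<Phi> (x, m), L (x, m))" by auto
      then show "y \<in> (Dv \<times> Dv) \<times> {..<M}" using \<Phi>(1) sol LM by blast
    qed
    have "(\<Sum>(x, m)\<in>F. real_of_int m powr (- lam)) \<le> (\<Sum>z\<in>F. w * q ^ L z)"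
      using trm by (intro sum_mono) auto
    also have "\<dots> = (\<Sum>y\<in>(\<lambda>z. (\<Phi> z, L z)) ` F. w * q ^ snd y)"
      by (simp add: sum.reindex[OF inj])
    also have "\<dots> \<le> (\<Sum>y\<in>(Dv \<times> Dv) \<times> {..<M}. w * q ^ snd y)"
      using img finDv w0 q by (intro sum_mono2) auto
    also have "\<dots> = (\<Sum>d\<in>Dv \<times> Dv. \<Sum>k<M. w * q ^ k)"
      unfolding sum.cartesian_product by (intro sum.cong) auto
    also have "\<dots> = real (card Dv)^2 * w * (\<Sum>k<M. q ^ k)"
      by (simp add: card_cartesian_product power2_eq_square flip: sum_distrib_left)
    also have "\<dots> \<le> real (card Dv)^2 * w * (1 / (1 - q))"
    proof -
      have "(\<Sum>k<M. q ^ k) \<le> (\<Sum>k. q ^ k)"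
        using q by (intro sum_le_suminf) auto
      then show ?thesis using w0 q by (intro mult_left_mono) (auto simp: suminf_geometric)
    qed
    also have "\<dots> \<le> (T * real (nat \<bar>N\<bar>) powr (lam / 16))^2 * w * (1 / (1 - q))"
    proof -
      have "real (card Dv) \<le> T * real (nat \<bar>N\<bar>) powr (lam / 16)"
        unfolding Dv_def using N by (intro T(2)) simp
      then show ?thesis using q w0 by (intro mult_right_mono power_mono) auto
    qed
    also have "\<dots> = C"
    proof -
      have "(real (nat \<bar>N\<bar>) powr (lam / 16))^2 * real (nat \<bar>N\<bar>) powr (- (lam / 8)) = 1"
        using N by (simp add: powr_power powr_minus)
      then show ?thesis by (simp add: C_def w_def power_mult_distrib mult_ac)
    qed
    finally show "(\<Sum>(x, m)\<in>F. real_of_int m powr (- lam)) \<le> C" .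
  qed
qed

text \<open>The solutions left over by the previous bound are those with
  \<open>D^2 * m^4 < \<bar>N\<bar>\<close>. There is at most one, and its weight is at most
  1.\<close>

lemma sum_pell_weights_bounded:
  fixes D :: int and lam :: real
  assumes D: "D > 0" and lam: "lam > 0"
  obtains C where "C \<ge> 0" "\<And>N F. \<lbrakk>N \<noteq> 0; finite F;
      \<And>x m. (x, m) \<in> F \<Longrightarrow> x \<ge> 0 \<and> m \<ge> 1 \<and> x^2 - D * m^2 = N\<rbrakk>
      \<Longrightarrow> (\<Sum>(x, m)\<in>F. real_of_int m powr (- lam)) \<le> C"
proof -
  obtain C where C: "C \<ge> 0" "\<And>N F. \<lbrakk>N \<noteq> 0; finite F;
      \<And>x m. (x, m) \<in> F \<Longrightarrow> x \<ge> 0 \<and> m \<ge> 1 \<and> x^2 - D * m^2 = N \<and> \<bar>N\<bar> \<le> D^2 * m^4\<rbrakk>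
      \<Longrightarrow> (\<Sum>(x, m)\<in>F. real_of_int m powr (- lam)) \<le> C"
    using sum_large_solutions_bounded[OF assms] by metis
  show ?thesis
  proof
    show "C + 1 \<ge> 0" using C by simp
    fix N F assume N: "N \<noteq> 0" and F: "finite F" and
      sol: "\<And>x m. (x, m) \<in> F \<Longrightarrow> x \<ge> 0 \<and> m \<ge> 1 \<and> x^2 - D * m^2 = N"
    define G where "G = {z \<in> F. \<bar>N\<bar> \<le> D^2 * snd z^4}"
    have card: "card (F - G) \<le> 1"
      using F sol by (intro card_small_solutions[OF D, of _ N]) (force simp: G_def)+
    have "(\<Sum>(x, m)\<in>F - G. real_of_int m powr (- lam)) \<le> (\<Sum>z\<in>F - G. 1)"
    proof (intro sum_mono)
      fix z assume "z \<in> F - G"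
      then have "1 \<le> snd z" using sol[of "fst z" "snd z"] by auto
      then show "(case z of (x, m) \<Rightarrow> real_of_int m powr - lam) \<le> 1"
        using lam powr_mono2'[of "- lam" 1 "real_of_int (snd z)"] by (simp add: case_prod_beta)
    qed
    then have 1: "(\<Sum>(x, m)\<in>F - G. real_of_int m powr (- lam)) \<le> 1" using card by simp
    have 2: "(\<Sum>(x, m)\<in>G. real_of_int m powr (- lam)) \<le> C"
      using F sol by (intro C(2)[OF N]) (auto simp: G_def)
    have "(\<Sum>(x, m)\<in>F. real_of_int m powr (- lam)) =
        (\<Sum>(x, m)\<in>F - G. real_of_int m powr (- lam)) + (\<Sum>(x, m)\<in>G. real_of_int m powr (- lam))"
      using F by (intro sum.subset_diff) (auto simp: G_def)
    with 1 2 show "(\<Sum>(x, m)\<in>F. real_of_int m powr (- lam)) \<le> C + 1" by linarith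
  qed
qed

section \<open>Boundedness\<close>

lemma four_mult_qf: "4 * c * qf a b c m n = (2 * c * n + b * m)^2 - disc a b c * m^2"
  unfolding qf_def disc_def by algebra

text \<open>Completing the square maps representations of \<open>k\<close> to solutions of norm
  \<open>4 * c * k\<close>. The Pell bound is uniform in the norm, so neither \<open>c\<close> nor
  \<open>k\<close> enters the constant.\<close>

lemma sum_form_weights_bounded:
  fixes D :: int and lam :: real
  assumes D: "D > 0" and nsq: "\<not> (\<exists>k::int. D = k^2)" and lam: "lam > 0"
  obtains C where "C \<ge> 0" "\<And>a b c k F. \<lbrakk>disc a b c = D; finite F;
      \<And>n m. (n, m) \<in> F \<Longrightarrow> m \<noteq> 0 \<and> qf a b c m n = k\<rbrakk>
      \<Longrightarrow> (\<Sum>(n, m)\<in>F. \<bar>real_of_int m\<bar> powr (- lam)) \<le> C"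
proof -
  obtain C where C: "C \<ge> 0" "\<And>N F. \<lbrakk>N \<noteq> 0; finite F;
      \<And>x m. (x, m) \<in> F \<Longrightarrow> x \<ge> 0 \<and> m \<ge> 1 \<and> x^2 - D * m^2 = N\<rbrakk>
      \<Longrightarrow> (\<Sum>(x, m)\<in>F. real_of_int m powr (- lam)) \<le> C"
    using sum_pell_weights_bounded[OF D lam] by metis
  show ?thesis
  proof
    show "4 * C \<ge> 0" using C by simp
    fix a b c k F assume abc: "disc a b c = D" and F: "finite F" and
      sol: "\<And>n m. (n, m) \<in> F \<Longrightarrow> m \<noteq> 0 \<and> qf a b c m n = k"
    have c0: "c \<noteq> 0" using abc nsq by (auto simp: disc_def)
    have eq: "(2 * c * n + b * m)^2 - D * m^2 = 4 * c * k" if "(n, m) \<in> F" for n m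
      using four_mult_qf[of c a b m n] sol[OF that] abc by simp
    show "(\<Sum>(n, m)\<in>F. \<bar>real_of_int m\<bar> powr (- lam)) \<le> 4 * C"
    proof (cases "F = {}")
      case True
      then show ?thesis using C by simp
    next
      case False
      then have N: "4 * c * k \<noteq> 0"
        using eq sol nonsquare_imp_no_zero[OF nsq] by (metis equals0I prod.collapse)
      define h where "h = (\<lambda>(n::int, m::int). (2 * c * n + b * m, m))"
      define g where "g = (\<lambda>(n::int, m::int). (\<bar>2 * c * n + b * m\<bar>, \<bar>m\<bar>))"
      have injh: "inj_on h A" for A
        using c0 by (auto simp: h_def inj_on_def)
      \<comment> \<open>The Pell bound concerns \<open>x \<ge> 0\<close> and
        \<open>m \<ge> 1\<close>; the four choices of signs account for the factor 4.\<close>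
      have fibre: "card {z \<in> F. g z = y} \<le> 4" for y
      proof -
        obtain X M where y: "y = (X, M)" by fastforce
        have "h ` {z \<in> F. g z = y} \<subseteq> {X, - X} \<times> {M, - M}"
          by (auto simp: h_def g_def y abs_if split: if_splits)
        then have "card {z \<in> F. g z = y} \<le> card ({X, - X} \<times> {M, - M})"
          using injh by (intro card_inj_on_le) auto
        also have "\<dots> \<le> 2 * 2"
          unfolding card_cartesian_product by (intro mult_mono) (auto simp: card_insert_if)
        finally show ?thesis by simp
      qed
      have "(\<Sum>(n, m)\<in>F. \<bar>real_of_int m\<bar> powr (- lam))
          = (\<Sum>z\<in>F. real_of_int (snd (g z)) powr (- lam))"
        by (intro sum.cong) (auto simp: g_def)
      also have "\<dots> = (\<Sum>y\<in>g ` F. \<Sum>z\<in>{z \<in> F. g z = y}. real_of_int (snd (g z)) powr (- lam))"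
        using F by (rule sum.image_gen)
      also have "\<dots> = (\<Sum>y\<in>g ` F. real (card {z \<in> F. g z = y}) * real_of_int (snd y) powr (- lam))"
        by (intro sum.cong) auto
      also have "\<dots> \<le> (\<Sum>y\<in>g ` F. 4 * real_of_int (snd y) powr (- lam))"
        using fibre by (intro sum_mono mult_right_mono) auto
      also have "\<dots> = 4 * (\<Sum>(x, m)\<in>g ` F. real_of_int m powr (- lam))"
        by (simp add: sum_distrib_left case_prod_beta)
      also have "\<dots> \<le> 4 * C"
      proof (intro mult_left_mono C(2)[OF N])
        fix x m assume "(x, m) \<in> g ` F"
        then obtain n' m' where z: "(n', m') \<in> F" "x = \<bar>2 * c * n' + b * m'\<bar>" "m = \<bar>m'\<bar>"
          by (auto simp: g_def)
        have "m' \<noteq> 0" using sol z by blast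
        then show "x \<ge> 0 \<and> m \<ge> 1 \<and> x^2 - D * m^2 = 4 * c * k"
          using eq[OF z(1)] z(2,3) by auto
      qed (use F in auto)
      finally show ?thesis .
    qed
  qed
qed

text \<open>The pairs \<open>(n, m)\<close> are grouped by the value \<open>k\<close> of the form,
  so each \<open>h k\<close> is multiplied by one of the bounded sums. For larger \<open>p\<close>
  it is applied to \<open>h = \<bar>f\<bar> powr p\<close> with another exponent.\<close>

lemma weighted_form_sum:
  fixes D :: int and lam :: real
  assumes D: "D > 0" and nsq: "\<not> (\<exists>k::int. D = k^2)" and lam: "lam > 0"
  shows "\<exists>C\<ge>0. \<forall>a b c (h :: int \<Rightarrow> real). disc a b c = D \<and> h summable_on UNIV \<and> (\<forall>k. h k \<ge> 0) \<longrightarrow>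
        (\<lambda>(n, m). h (qf a b c m n) * \<bar>real_of_int m\<bar> powr (- lam)) summable_on (UNIV \<times> (UNIV - {0}))
        \<and> (\<Sum>\<^sub>\<infinity>(n, m)\<in>UNIV \<times> (UNIV - {0}). h (qf a b c m n) * \<bar>real_of_int m\<bar> powr (- lam))
            \<le> C * (\<Sum>\<^sub>\<infinity>k. h k)"
proof -
  obtain C where C: "C \<ge> 0" "\<And>a b c k F. \<lbrakk>disc a b c = D; finite F;
      \<And>n m. (n, m) \<in> F \<Longrightarrow> m \<noteq> 0 \<and> qf a b c m n = k\<rbrakk>
      \<Longrightarrow> (\<Sum>(n, m)\<in>F. \<bar>real_of_int m\<bar> powr (- lam)) \<le> C"
    using sum_form_weights_bounded[OF assms] by metis
  show ?thesis
  proof (intro exI[of _ C] conjI[OF C(1)] allI impI, elim conjE)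
    fix a b c and h :: "int \<Rightarrow> real"
    assume abc: "disc a b c = D" and h: "h summable_on UNIV" "\<forall>k. h k \<ge> 0"
    define t where "t = (\<lambda>(n::int, m). h (qf a b c m n) * \<bar>real_of_int m\<bar> powr (- lam))"
    have t0: "t z \<ge> 0" for z using h by (auto simp: t_def split: prod.splits)
    have fin: "sum t F \<le> C * (\<Sum>\<^sub>\<infinity>k. h k)" if F: "finite F" "F \<subseteq> UNIV \<times> (UNIV - {0})" for F
    proof -
      define q where "q = (\<lambda>(n, m). qf a b c m n)"
      have "sum t F = (\<Sum>k\<in>q ` F. sum t {z \<in> F. q z = k})"
        using F(1) by (rule sum.image_gen)
      also have "\<dots> = (\<Sum>k\<in>q ` F. h k * (\<Sum>(n, m)\<in>{z \<in> F. q z = k}. \<bar>real_of_int m\<bar> powr (- lam)))"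
        unfolding sum_distrib_left by (intro sum.cong refl) (auto simp: t_def q_def)
      also have "\<dots> \<le> (\<Sum>k\<in>q ` F. h k * C)"
        using F h abc by (intro sum_mono mult_left_mono C(2)) (auto simp: q_def)
      also have "\<dots> = C * sum h (q ` F)" by (simp add: sum_distrib_left mult.commute)
      also have "\<dots> \<le> C * (\<Sum>\<^sub>\<infinity>k. h k)"
        using F h C by (intro mult_left_mono finite_sum_le_infsum) auto
      finally show ?thesis .
    qed
    have s: "t summable_on (UNIV \<times> (UNIV - {0}))"
      using t0 fin by (intro nonneg_bdd_above_summable_on bdd_aboveI2[where M = "C * (\<Sum>\<^sub>\<infinity>k. h k)"]) auto
    then have "infsum t (UNIV \<times> (UNIV - {0})) \<le> C * (\<Sum>\<^sub>\<infinity>k. h k)"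
      using fin by (rule infsum_le_finite_sums)
    with s show "(\<lambda>(n, m). h (qf a b c m n) * \<bar>real_of_int m\<bar> powr (- lam)) summable_on (UNIV \<times> (UNIV - {0}))
        \<and> (\<Sum>\<^sub>\<infinity>(n, m)\<in>UNIV \<times> (UNIV - {0}). h (qf a b c m n) * \<bar>real_of_int m\<bar> powr (- lam))
            \<le> C * (\<Sum>\<^sub>\<infinity>k. h k)"
      by (simp add: t_def)
  qed
qed

text \<open>Convexity of \<open>x powr p\<close>, with the weights divided by their total
  \<open>V\<close>. Undoing the division leaves \<open>V powr (p - 1)\<close>, which grows with
  \<open>V\<close> because \<open>p \<ge> 1\<close>.\<close>

lemma powr_weighted_sum_le:
  fixes w t :: "'i \<Rightarrow> real"
  assumes F: "finite F" and w: "\<And>i. i \<in> F \<Longrightarrow> w i > 0" and t: "\<And>i. i \<in> F \<Longrightarrow> t i \<ge> 0"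
    and p: "p \<ge> 1" and W: "sum w F \<le> W"
  shows "(\<Sum>i\<in>F. w i * t i) powr p \<le> W powr (p - 1) * (\<Sum>i\<in>F. w i * t i powr p)"
proof -
  \<comment> \<open>Convexity is used on the open half-line; terms with \<open>t i = 0\<close>
    contribute to neither side.\<close>
  define E where "E = {i \<in> F. t i > 0}"
  have E: "finite E" "E \<subseteq> F" using F by (auto simp: E_def)
  have 1: "(\<Sum>i\<in>F. w i * t i) = (\<Sum>i\<in>E. w i * t i)"
    using F t by (intro sum.mono_neutral_right) (auto simp: E_def less_le)
  have 2: "(\<Sum>i\<in>F. w i * t i powr p) = (\<Sum>i\<in>E. w i * t i powr p)"
    using F t by (intro sum.mono_neutral_right) (auto simp: E_def less_le)
  show ?thesis
  proof (cases "E = {}")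
    case True
    then show ?thesis using 1 2 by simp
  next
    case False
    define V where "V = sum w E"
    have V: "V > 0" unfolding V_def using False E w by (intro sum_pos) auto
    have "V \<le> W"
    proof -
      have "V \<le> sum w F" unfolding V_def using F E w by (intro sum_mono2) (auto intro: less_imp_le)
      with W show ?thesis by simp
    qed
    have "(\<Sum>i\<in>E. (w i / V) *\<^sub>R t i) powr p \<le> (\<Sum>i\<in>E. (w i / V) * t i powr p)"
    proof (rule convex_on_sum[where C = "{0<..}" and f = "\<lambda>x. x powr p"])
      show "convex_on {0<..} (\<lambda>x. x powr p)" using p by (rule powr_convex)
      show "(\<Sum>i\<in>E. w i / V) = 1" using V by (simp add: V_def flip: sum_divide_distrib)
    qed (use E False w V in \<open>auto simp: E_def intro: less_imp_le\<close>)
    then have "((\<Sum>i\<in>E. w i * t i) / V) powr p \<le> (\<Sum>i\<in>E. w i * t i powr p) / V"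
      by (simp add: sum_divide_distrib)
    moreover have s0: "(\<Sum>i\<in>E. w i * t i) \<ge> 0"
      using E w t by (intro sum_nonneg mult_nonneg_nonneg) (auto intro: less_imp_le)
    ultimately have "(\<Sum>i\<in>E. w i * t i) powr p / V powr p \<le> (\<Sum>i\<in>E. w i * t i powr p) / V"
      using V by (simp add: powr_divide)
    then have "(\<Sum>i\<in>E. w i * t i) powr p \<le> (\<Sum>i\<in>E. w i * t i powr p) / V * V powr p"
      using V by (simp add: pos_divide_le_eq)
    also have "\<dots> = V powr (p - 1) * (\<Sum>i\<in>E. w i * t i powr p)"
      using V by (simp add: powr_diff)
    also have "\<dots> \<le> W powr (p - 1) * (\<Sum>i\<in>E. w i * t i powr p)"
    proof (intro mult_right_mono powr_mono2)
      show "(\<Sum>i\<in>E. w i * t i powr p) \<ge> 0"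
        using E w by (intro sum_nonneg mult_nonneg_nonneg) (auto intro: less_imp_le)
    qed (use p V \<open>V \<le> W\<close> in auto)
    finally show ?thesis using 1 2 by simp
  qed
qed

lemma abs_powr_summable_on_int:
  fixes s :: real
  assumes "s > 1"
  shows "(\<lambda>m::int. \<bar>real_of_int m\<bar> powr (- s)) summable_on A"
proof -
  have "(\<lambda>n::nat. real n powr (- s)) summable_on UNIV"
    using assms by (intro norm_summable_imp_summable_on) (simp add: summable_real_powr_iff)
  then have "(\<lambda>m::int. \<bar>real_of_int m\<bar> powr (- s)) summable_on range int"
    and "(\<lambda>m::int. \<bar>real_of_int m\<bar> powr (- s)) summable_on range (\<lambda>n. - int n)"
    by (simp_all add: summable_on_reindex inj_on_def o_def)
  then have "(\<lambda>m::int. \<bar>real_of_int m\<bar> powr (- s)) summable_on (range int \<union> range (\<lambda>n. - int n))"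
    by (rule summable_on_union)
  moreover have "A \<subseteq> range int \<union> range (\<lambda>n. - int n)"
  proof
    fix m
    show "m \<in> range int \<union> range (\<lambda>n. - int n)" by (cases m rule: int_cases2) auto
  qed
  ultimately show ?thesis by (rule summable_on_subset_banach)
qed

text \<open>Write \<open>\<bar>m\<bar> powr (- lam)\<close> as
  \<open>\<bar>m\<bar> powr (- s)\<close> times \<open>\<bar>m\<bar> powr (s - lam)\<close>. Jensen
  with the first factor as weight bounds the \<open>p\<close>-th power of a row by sums of
  \<open>norm f powr p\<close> against \<open>\<bar>m\<bar> powr (- \<beta>)\<close>. For
  \<open>p > 1\<close>, a suitable \<open>s > 1\<close> with \<open>\<beta> > 0\<close> exists
  because \<open>lam * p > p - 1\<close>; for \<open>p = 1\<close> any \<open>s > 1\<close> gives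
  \<open>\<beta> = lam\<close>.\<close>

lemma bounded_lp:
  fixes p lam :: real and D :: int
  assumes p: "1 \<le> p" and lam: "lam > 1 - 1 / p" and D: "D > 0" and nsq: "\<not> (\<exists>k::int. D = k^2)"
  shows "\<exists>C::real. \<forall>a b c. disc a b c = D \<longrightarrow>
          (\<forall>f::int \<Rightarrow> complex. lp_mem p f \<longrightarrow>
             (\<forall>n. (\<lambda>m. f (qf a b c m n) / complex_of_real (\<bar>real_of_int m\<bar> powr lam))
                    summable_on (UNIV - {0})) \<and>
             lp_mem p (Ilam a b c lam f) \<and>
             lp_norm p (Ilam a b c lam f) \<le> C * lp_norm p f)"
proof -
  obtain s where s: "s > 1" "s * (p - 1) < lam * p"
  proof (cases "p = 1")
    case True
    then show ?thesis using that[of 2] lam by simp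
  next
    case False
    with p have "p > 1" by simp
    then have "1 < lam * p / (p - 1)" using lam by (simp add: field_simps)
    then obtain s where "1 < s" "s < lam * p / (p - 1)" using dense by blast
    then show ?thesis using that[of s] \<open>p > 1\<close> by (simp add: pos_less_divide_eq)
  qed
  define \<beta> where "\<beta> = lam * p - s * (p - 1)"
  have \<beta>: "\<beta> > 0" using s by (simp add: \<beta>_def)
  define W where "W = (\<Sum>\<^sub>\<infinity>m\<in>UNIV - {0}. \<bar>real_of_int m\<bar> powr (- s))"
  obtain C where C: "C \<ge> 0" "\<forall>a b c (h :: int \<Rightarrow> real). disc a b c = D \<and> h summable_on UNIV \<and> (\<forall>k. h k \<ge> 0) \<longrightarrow>
        (\<lambda>(n, m). h (qf a b c m n) * \<bar>real_of_int m\<bar> powr (- \<beta>)) summable_on (UNIV \<times> (UNIV - {0}))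
        \<and> (\<Sum>\<^sub>\<infinity>(n, m)\<in>UNIV \<times> (UNIV - {0}). h (qf a b c m n) * \<bar>real_of_int m\<bar> powr (- \<beta>))
            \<le> C * (\<Sum>\<^sub>\<infinity>k. h k)"
    using weighted_form_sum[OF D nsq \<beta>] by blast
  show ?thesis
  \<comment> \<open>\<open>W powr (p - 1)\<close> comes from Jensen and \<open>C\<close> from the
    weighted double sum, both before the \<open>p\<close>-th root is taken.\<close>
  proof (intro exI[of _ "(W powr (p - 1) * C) powr (1 / p)"] allI impI)
    fix a b c and f :: "int \<Rightarrow> complex"
    assume abc: "disc a b c = D" and f: "lp_mem p f"
    define h where "h = (\<lambda>k. norm (f k) powr p)"
    have h: "h summable_on UNIV" "\<And>k. h k \<ge> 0" using f by (auto simp: lp_mem_def h_def)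
    define t where "t n m = h (qf a b c m n) * \<bar>real_of_int m\<bar> powr (- \<beta>)" for n m
    have tS: "(\<lambda>(n, m). t n m) summable_on (UNIV \<times> (UNIV - {0}))"
      and tle: "(\<Sum>\<^sub>\<infinity>(n, m)\<in>UNIV \<times> (UNIV - {0}). t n m) \<le> C * (\<Sum>\<^sub>\<infinity>k. h k)"
      using C(2)[rule_format, of a b c h] abc h by (auto simp: t_def)
    have t0: "t n m \<ge> 0" for n m using h by (simp add: t_def)
    define G where "G = (\<lambda>n. \<Sum>\<^sub>\<infinity>m\<in>UNIV - {0}. t n m)"
    have tn: "t n summable_on (UNIV - {0})" for n
      using summable_on_SigmaD1[OF tS, of n] by simp
    have G0: "G n \<ge> 0" for n unfolding G_def by (intro infsum_nonneg t0)
    have GS: "G summable_on UNIV"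
      using summable_on_Sigma_banach[OF tS] by (simp add: G_def)
    have Gle: "(\<Sum>\<^sub>\<infinity>n. G n) \<le> C * (\<Sum>\<^sub>\<infinity>k. h k)"
      using infsum_Sigma'_banach[OF tS] tle by (simp add: G_def)
    define g where "g = (\<lambda>n m. f (qf a b c m n) / complex_of_real (\<bar>real_of_int m\<bar> powr lam))"
    define B where "B n = (W powr (p - 1) * G n) powr (1 / p)" for n
    have fin: "(\<Sum>m\<in>F. norm (g n m)) \<le> B n" if F: "finite F" "F \<subseteq> UNIV - {0}" for n F
    proof -
      have "(\<Sum>m\<in>F. norm (g n m)) = (\<Sum>m\<in>F. \<bar>real_of_int m\<bar> powr (- s) *
          (norm (f (qf a b c m n)) * \<bar>real_of_int m\<bar> powr (s - lam)))"
      proof (intro sum.cong refl)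
        fix m assume "m \<in> F"
        then have m: "m \<noteq> 0" using F by auto
        have "\<bar>real_of_int m\<bar> powr (- s) * \<bar>real_of_int m\<bar> powr (s - lam) = \<bar>real_of_int m\<bar> powr (- lam)"
          by (simp flip: powr_add)
        moreover have "norm (g n m) = norm (f (qf a b c m n)) * \<bar>real_of_int m\<bar> powr (- lam)"
          by (simp add: g_def norm_divide powr_minus_divide)
        ultimately show "norm (g n m) = \<bar>real_of_int m\<bar> powr (- s) *
          (norm (f (qf a b c m n)) * \<bar>real_of_int m\<bar> powr (s - lam))"
          by (metis mult.left_commute)
      qed
      also have "\<dots> powr p \<le> W powr (p - 1) * (\<Sum>m\<in>F. \<bar>real_of_int m\<bar> powr (- s) *
          (norm (f (qf a b c m n)) * \<bar>real_of_int m\<bar> powr (s - lam)) powr p)"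
        using F p unfolding W_def
        by (intro powr_weighted_sum_le finite_sum_le_infsum abs_powr_summable_on_int s) auto
      also have "(\<Sum>m\<in>F. \<bar>real_of_int m\<bar> powr (- s) *
          (norm (f (qf a b c m n)) * \<bar>real_of_int m\<bar> powr (s - lam)) powr p) = sum (t n) F"
      proof (intro sum.cong refl)
        fix m
        have "\<bar>real_of_int m\<bar> powr (- s) * \<bar>real_of_int m\<bar> powr ((s - lam) * p) = \<bar>real_of_int m\<bar> powr (- \<beta>)"
          by (simp add: \<beta>_def algebra_simps flip: powr_add)
        moreover have "(norm (f (qf a b c m n)) * \<bar>real_of_int m\<bar> powr (s - lam)) powr p
            = h (qf a b c m n) * \<bar>real_of_int m\<bar> powr ((s - lam) * p)"
          by (simp add: h_def powr_mult powr_powr)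
        ultimately show "\<bar>real_of_int m\<bar> powr (- s) *
          (norm (f (qf a b c m n)) * \<bar>real_of_int m\<bar> powr (s - lam)) powr p = t n m"
          unfolding t_def by (metis mult.left_commute)
      qed
      also have "W powr (p - 1) * sum (t n) F \<le> W powr (p - 1) * G n"
        unfolding G_def using F t0 tn by (intro mult_left_mono finite_sum_le_infsum) auto
      finally have "(\<Sum>m\<in>F. norm (g n m)) powr p \<le> W powr (p - 1) * G n" .
      then have "((\<Sum>m\<in>F. norm (g n m)) powr p) powr (1 / p) \<le> B n"
        unfolding B_def using p by (intro powr_mono2) auto
      then show ?thesis using p by (simp add: powr_powr sum_nonneg)
    qed
    have abs_g: "(\<lambda>m. norm (g n m)) summable_on (UNIV - {0})" for n
      using fin[of _ n] by (intro nonneg_bdd_above_summable_on bdd_aboveI2[where M = "B n"]) auto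
    have gS: "g n summable_on (UNIV - {0})" for n by (rule abs_summable_summable[OF abs_g])
    have Ig: "Ilam a b c lam f n = infsum (g n) (UNIV - {0})" for n
      by (simp add: Ilam_def g_def)
    have norm_I: "norm (Ilam a b c lam f n) powr p \<le> W powr (p - 1) * G n" for n
    proof -
      have "norm (Ilam a b c lam f n) \<le> (\<Sum>\<^sub>\<infinity>m\<in>UNIV - {0}. norm (g n m))"
        unfolding Ig by (rule norm_infsum_bound[OF abs_g])
      also have "\<dots> \<le> B n" by (rule infsum_le_finite_sums[OF abs_g fin])
      finally have "norm (Ilam a b c lam f n) powr p \<le> B n powr p" using p by (intro powr_mono2) auto
      then show ?thesis using p G0 by (simp add: B_def powr_powr)
    qed
    have WGS: "(\<lambda>n. W powr (p - 1) * G n) summable_on UNIV" by (rule summable_on_cmult_right[OF GS])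
    have IS: "(\<lambda>n. norm (Ilam a b c lam f n) powr p) summable_on UNIV"
      using norm_I by (intro summable_on_comparison_test[OF WGS]) auto
    have "(\<Sum>\<^sub>\<infinity>n. norm (Ilam a b c lam f n) powr p) \<le> (\<Sum>\<^sub>\<infinity>n. W powr (p - 1) * G n)"
      by (rule infsum_mono[OF IS WGS norm_I])
    also have "\<dots> = W powr (p - 1) * (\<Sum>\<^sub>\<infinity>n. G n)" by (rule infsum_cmult_right')
    also have "\<dots> \<le> W powr (p - 1) * (C * (\<Sum>\<^sub>\<infinity>k. h k))" using Gle by (intro mult_left_mono) auto
    finally have "lp_norm p (Ilam a b c lam f) \<le> (W powr (p - 1) * (C * (\<Sum>\<^sub>\<infinity>k. h k))) powr (1 / p)"
      unfolding lp_norm_def using p by (intro powr_mono2 infsum_nonneg) auto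
    also have "\<dots> = (W powr (p - 1) * C) powr (1 / p) * lp_norm p f"
      unfolding lp_norm_def h_def by (simp add: mult.assoc flip: powr_mult)
    finally have "lp_norm p (Ilam a b c lam f) \<le> (W powr (p - 1) * C) powr (1 / p) * lp_norm p f" .
    with gS IS show "(\<forall>n. (\<lambda>m. f (qf a b c m n) / complex_of_real (\<bar>real_of_int m\<bar> powr lam))
        summable_on (UNIV - {0})) \<and>
      lp_mem p (Ilam a b c lam f) \<and>
      lp_norm p (Ilam a b c lam f) \<le> (W powr (p - 1) * C) powr (1 / p) * lp_norm p f"
      by (simp add: lp_mem_def g_def)
  qed
qed

text \<open>For \<open>lam > 1\<close> the weights are summable by themselves, so the triangle
  inequality suffices and the constant is their total.\<close>

lemma bounded_linf:
  fixes lam :: real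
  assumes lam: "lam > 1"
  shows "\<exists>C::real. \<forall>a b c. \<forall>f::int \<Rightarrow> complex. linf_mem f \<longrightarrow>
             (\<forall>n. (\<lambda>m. f (qf a b c m n) / complex_of_real (\<bar>real_of_int m\<bar> powr lam))
                    summable_on (UNIV - {0})) \<and>
             linf_mem (Ilam a b c lam f) \<and>
             linf_norm (Ilam a b c lam f) \<le> C * linf_norm f"
proof -
  define W where "W = (\<Sum>\<^sub>\<infinity>m\<in>UNIV - {0}. \<bar>real_of_int m\<bar> powr (- lam))"
  show ?thesis
  proof (intro exI[of _ W] allI impI)
    fix a b c and f :: "int \<Rightarrow> complex" assume f: "linf_mem f"
    define g where "g = (\<lambda>n m. f (qf a b c m n) / complex_of_real (\<bar>real_of_int m\<bar> powr lam))"
    have bdd: "bdd_above (range (\<lambda>k. norm (f k)))"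
      using f by (simp add: linf_mem_def bounded_iff bdd_above_def image_iff)
    have f_le: "norm (f k) \<le> linf_norm f" for k
      unfolding linf_norm_def by (rule cSUP_upper[OF _ bdd]) simp
    have wS: "(\<lambda>m. linf_norm f * \<bar>real_of_int m\<bar> powr (- lam)) summable_on (UNIV - {0})"
      by (intro summable_on_cmult_right abs_powr_summable_on_int lam)
    have g_le: "norm (g n m) \<le> linf_norm f * \<bar>real_of_int m\<bar> powr (- lam)" for n m
      using f_le[of "qf a b c m n"]
      by (simp add: g_def norm_divide powr_minus_divide divide_right_mono)
    have abs_g: "(\<lambda>m. norm (g n m)) summable_on (UNIV - {0})" for n
      using g_le by (intro summable_on_comparison_test[OF wS]) auto
    have I_le: "norm (Ilam a b c lam f n) \<le> W * linf_norm f" for n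
    proof -
      have "norm (Ilam a b c lam f n) \<le> (\<Sum>\<^sub>\<infinity>m\<in>UNIV - {0}. norm (g n m))"
        using norm_infsum_bound[OF abs_g] by (simp add: Ilam_def g_def)
      also have "\<dots> \<le> (\<Sum>\<^sub>\<infinity>m\<in>UNIV - {0}. linf_norm f * \<bar>real_of_int m\<bar> powr (- lam))"
        by (rule infsum_mono[OF abs_g wS g_le])
      also have "\<dots> = W * linf_norm f" by (simp add: W_def infsum_cmult_right' mult.commute)
      finally show ?thesis .
    qed
    have "linf_mem (Ilam a b c lam f)"
      using I_le by (auto simp: linf_mem_def bounded_iff)
    moreover have "linf_norm (Ilam a b c lam f) \<le> W * linf_norm f"
      unfolding linf_norm_def[of "Ilam a b c lam f"] using I_le by (intro cSUP_least) auto
    moreover have "g n summable_on (UNIV - {0})" for n by (rule abs_summable_summable[OF abs_g])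
    ultimately show "(\<forall>n. (\<lambda>m. f (qf a b c m n) / complex_of_real (\<bar>real_of_int m\<bar> powr lam))
          summable_on (UNIV - {0})) \<and>
      linf_mem (Ilam a b c lam f) \<and> linf_norm (Ilam a b c lam f) \<le> W * linf_norm f"
      by (simp add: g_def)
  qed
qed

section \<open>Sharpness\<close>

lemma finite_sum_le_infsum_ennreal:
  fixes f :: "'i \<Rightarrow> ennreal"
  assumes "finite F" "F \<subseteq> A"
  shows "sum f F \<le> infsum f A"
proof -
  have "infsum f F \<le> infsum f A"
    using assms by (intro infsum_mono_neutral nonneg_summable_on_complete) auto
  then show ?thesis using assms by simp
qed

text \<open>A divergent minorant on the positive half of one row is enough. The index 0 is exempt
  from the comparison, because the operator omits \<open>m = 0\<close> and a single term does not
  affect summability.\<close>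

lemma Iw_eq_top:
  fixes \<phi> :: "nat \<Rightarrow> real"
  assumes "\<not> summable \<phi>" "\<And>i. \<phi> i \<ge> 0"
    and le: "\<And>i. i > 0 \<Longrightarrow> \<phi> i \<le> f (qf a b c (int i) n) / w (int i)"
  shows "Iw a b c w f n = \<infinity>"
proof (rule ccontr)
  assume "Iw a b c w f n \<noteq> \<infinity>"
  then obtain r where r: "Iw a b c w f n = ennreal r" "r \<ge> 0"
    by (cases "Iw a b c w f n") auto
  have "(\<Sum>i<N. \<phi> i) \<le> \<phi> 0 + r" for N
  proof -
    have "ennreal (\<Sum>i\<in>{1..<N}. \<phi> i) = (\<Sum>i\<in>{1..<N}. ennreal (\<phi> i))"
      using assms(2) by simp
    also have "\<dots> \<le> (\<Sum>i\<in>{1..<N}. ennreal (f (qf a b c (int i) n) / w (int i)))"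
      using le by (intro sum_mono ennreal_leI) auto
    also have "\<dots> = (\<Sum>m\<in>int ` {1..<N}. ennreal (f (qf a b c m n) / w m))"
      by (simp add: sum.reindex)
    also have "\<dots> \<le> Iw a b c w f n"
      unfolding Iw_def by (intro finite_sum_le_infsum_ennreal) auto
    finally have "(\<Sum>i\<in>{1..<N}. \<phi> i) \<le> r" using r by (simp add: ennreal_le_iff)
    moreover have "(\<Sum>i<N. \<phi> i) \<le> (\<Sum>i\<in>insert 0 {1..<N}. \<phi> i)"
      using assms(2) by (intro sum_mono2) auto
    ultimately show ?thesis by simp
  qed
  then have "summable \<phi>" using assms(2) by (intro summableI_nonneg_bounded)
  with assms(1) show False by contradiction
qed

lemma lp_normE_top: "g n = \<infinity> \<Longrightarrow> lp_normE p g = \<infinity>"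
  by (auto simp: lp_normE_def)

text \<open>For \<open>p = 1\<close> the norm is the sum over all pairs \<open>(n, m)\<close>, so
  finite sets of pairs with arbitrarily large sums suffice; no single row has to diverge.\<close>

lemma lp_normE_1_Iw_eq_top:
  assumes "\<And>M::real. \<exists>F. finite F \<and> F \<subseteq> UNIV \<times> (UNIV - {0}) \<and>
      (\<forall>(n, m)\<in>F. f (qf a b c m n) / w m \<ge> 0) \<and> M \<le> (\<Sum>(n, m)\<in>F. f (qf a b c m n) / w m)"
  shows "lp_normE 1 (Iw a b c w f) = \<infinity>"
proof (cases "\<exists>n. Iw a b c w f n = \<infinity>")
  case True
  then show ?thesis by (auto simp: lp_normE_def)
next
  case False
  define S where "S = (\<Sum>\<^sub>\<infinity>n. Iw a b c w f n)"
  \<comment> \<open>Every row is finite in this case, so the detour through the reals in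
    \<open>lp_normE\<close> loses nothing.\<close>
  have "ennreal (enn2real (Iw a b c w f n) powr 1) = Iw a b c w f n" for n
    using False by (simp add: less_top)
  moreover have "ennreal M \<le> S" for M
  proof -
    obtain F where F: "finite F" "F \<subseteq> UNIV \<times> (UNIV - {0})"
      "\<forall>(n, m)\<in>F. f (qf a b c m n) / w m \<ge> 0" "M \<le> (\<Sum>(n, m)\<in>F. f (qf a b c m n) / w m)"
      using assms[of M] by blast
    have "ennreal M \<le> ennreal (\<Sum>(n, m)\<in>F. f (qf a b c m n) / w m)"
      using F(4) by (rule ennreal_leI)
    also have "\<dots> = (\<Sum>z\<in>F. case z of (n, m) \<Rightarrow> ennreal (f (qf a b c m n) / w m))"
      by (subst sum_ennreal[symmetric]) (use F(3) in \<open>auto intro!: sum.cong\<close>)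
    also have "\<dots> = (\<Sum>n\<in>fst ` F. \<Sum>z\<in>{z \<in> F. fst z = n}. case z of (n, m) \<Rightarrow> ennreal (f (qf a b c m n) / w m))"
      using F(1) by (rule sum.image_gen)
    also have "\<dots> \<le> (\<Sum>n\<in>fst ` F. Iw a b c w f n)"
    proof (intro sum_mono)
      fix n
      have "(\<Sum>z\<in>{z \<in> F. fst z = n}. case z of (n, m) \<Rightarrow> ennreal (f (qf a b c m n) / w m))
          = (\<Sum>z\<in>{z \<in> F. fst z = n}. ennreal (f (qf a b c (snd z) n) / w (snd z)))"
        by (intro sum.cong) auto
      also have "\<dots> = (\<Sum>m\<in>snd ` {z \<in> F. fst z = n}. ennreal (f (qf a b c m n) / w m))"
        by (subst sum.reindex) (auto simp: inj_on_def)
      also have "\<dots> \<le> Iw a b c w f n"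
        unfolding Iw_def using F by (intro finite_sum_le_infsum_ennreal) auto
      finally show "(\<Sum>z\<in>{z \<in> F. fst z = n}. case z of (n, m) \<Rightarrow> ennreal (f (qf a b c m n) / w m))
          \<le> Iw a b c w f n" .
    qed
    also have "\<dots> \<le> S" unfolding S_def using F by (intro finite_sum_le_infsum_ennreal) auto
    finally show ?thesis .
  qed
  have "S = \<infinity>"
  proof (rule ccontr)
    assume "S \<noteq> \<infinity>"
    then obtain r where "S = ennreal r" "r \<ge> 0" by (cases S) auto
    with \<open>\<And>M. ennreal M \<le> S\<close>[of "r + 1"] show False by (simp add: ennreal_le_iff)
  qed
  ultimately show ?thesis using False by (simp add: lp_normE_def S_def)
qed

text \<open>For injective \<open>\<kappa>\<close> this transports the sequence \<open>h\<close> to a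
  sparse set of integers without changing its \<open>p\<close>-th power sum, so values can be
  prescribed exactly where the form is to hit.\<close>

definition spread :: "(nat \<Rightarrow> int) \<Rightarrow> (nat \<Rightarrow> real) \<Rightarrow> int \<Rightarrow> real" where
  "spread \<kappa> h k = (if k \<in> range \<kappa> then h (inv \<kappa> k) else 0)"

lemma spread_apply: "inj \<kappa> \<Longrightarrow> spread \<kappa> h (\<kappa> i) = h i"
  by (simp add: spread_def)

lemma spread_nonneg: "(\<And>i. h i \<ge> 0) \<Longrightarrow> spread \<kappa> h k \<ge> 0"
  by (simp add: spread_def)

lemma lp_mem_spread:
  assumes "inj \<kappa>" and "\<And>i. h i \<ge> 0" and "summable (\<lambda>i. h i powr p)"
  shows "lp_mem p (spread \<kappa> h)"
proof -
  have "(\<lambda>i. h i powr p) summable_on UNIV"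
    using assms(3) by (intro norm_summable_imp_summable_on) simp
  then have "((\<lambda>k. norm (spread \<kappa> h k) powr p) \<circ> \<kappa>) summable_on UNIV"
    using assms(1,2) by (simp add: o_def spread_apply)
  then have "(\<lambda>k. norm (spread \<kappa> h k) powr p) summable_on range \<kappa>"
    using assms(1) by (simp add: summable_on_reindex)
  then show ?thesis
    unfolding lp_mem_def by (subst summable_on_cong_neutral[where T = "range \<kappa>" and g = "\<lambda>k. norm (spread \<kappa> h k) powr p"])
      (auto simp: spread_def)
qed

text \<open>The first coefficient belongs to \<open>m\<close>, so this is
  \<open>n^2 - 2 * m^2\<close>; its discriminant 8 lies strictly between \<open>2^2\<close> and
  \<open>3^2\<close>.\<close>

lemma good_form_neg2_0_1: "good_form (- 2) 0 1"
proof -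
  have False if "(8::int) = k^2" for k
  proof -
    have "\<bar>k\<bar>^2 < 3^2" using that by simp
    then have "\<bar>k\<bar> < 3" by (rule power2_less_imp_less) simp
    then have "k \<in> {-2, -1, 0, 1, 2}" by auto
    then show False using that by auto
  qed
  then show ?thesis by (auto simp: good_form_def disc_def)
qed

section \<open>Divergence of the row \<open>n = 0\<close> for \<open>p > 1\<close>, including
  \<open>p = \<infinity>\<close>\<close>

lemma linf_counterexample:
  "linf_normE (Iw a b c (\<lambda>m. \<bar>real_of_int m\<bar>) (\<lambda>_. 1)) = \<infinity>"
proof -
  have "Iw a b c (\<lambda>m. \<bar>real_of_int m\<bar>) (\<lambda>_. 1) 0 = \<infinity>"
    by (rule Iw_eq_top[of "\<lambda>i. 1 / real i"])
      (use not_summable_harmonic[where ?'a = real] in \<open>auto simp: divide_inverse\<close>)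
  then show ?thesis
    unfolding linf_normE_def by (metis SUP_upper UNIV_I infinity_ennreal_def top.extremum_unique)
qed

text \<open>Condensation at \<open>2 ^ n\<close> leaves essentially \<open>n powr (- p)\<close>, and
  the harmonic series when the logarithm has exponent 1. This contrast separates membership in the
  space from divergence of the row. The shift in \<open>ln (i + 1)\<close> keeps the logarithm
  positive from \<open>i = 1\<close> on, and the term at 0 is 0.\<close>

lemma summable_inverse_mult_ln_powr:
  fixes p :: real
  assumes "p > 1"
  shows "summable (\<lambda>i::nat. 1 / (real i * ln (real i + 1) powr p))"
proof (subst condensation_test)
  fix m :: nat assume m: "m > 0"
  show "1 / (real (Suc m) * ln (real (Suc m) + 1) powr p) \<le> 1 / (real m * ln (real m + 1) powr p)"
    using m assms by (intro divide_left_mono mult_mono powr_mono2 mult_pos_pos) auto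
next
  show "summable (\<lambda>n. 2 ^ n * (1 / (real (2 ^ n) * ln (real (2 ^ n) + 1) powr p)))"
  proof (rule summable_comparison_test'[where N = 1])
    show "summable (\<lambda>n::nat. ln 2 powr (- p) * real n powr (- p))"
      using assms by (intro summable_mult) (simp add: summable_real_powr_iff)
    fix n :: nat assume n: "n \<ge> 1"
    have "real n * ln 2 = ln (2 ^ n)" by (simp add: ln_realpow)
    also have "\<dots> \<le> ln (2 ^ n + 1)" by (intro ln_mono) (auto intro: add_pos_pos)
    finally have "ln (2 ^ n + 1) powr (- p) \<le> (real n * ln 2) powr (- p)"
      using n assms by (intro powr_mono2') auto
    then show "norm (2 ^ n * (1 / (real (2 ^ n) * ln (real (2 ^ n) + 1) powr p)))
        \<le> ln 2 powr (- p) * real n powr (- p)"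
      by (simp add: powr_mult powr_minus_divide mult.commute)
  qed
qed auto

lemma not_summable_inverse_mult_ln:
  "\<not> summable (\<lambda>i::nat. 1 / (real i * ln (real i + 1)))"
proof (subst condensation_test)
  fix m :: nat assume m: "m > 0"
  show "1 / (real (Suc m) * ln (real (Suc m) + 1)) \<le> 1 / (real m * ln (real m + 1))"
    using m by (intro divide_left_mono mult_mono mult_pos_pos) auto
next
  show "\<not> summable (\<lambda>n. 2 ^ n * (1 / (real (2 ^ n) * ln (real (2 ^ n) + 1))))"
  proof
    assume "summable (\<lambda>n. 2 ^ n * (1 / (real (2 ^ n) * ln (real (2 ^ n) + 1))))"
    then have "summable (\<lambda>n. ln 2 * (1 / ln (2 ^ n + 1)) :: real)"
      by (intro summable_mult) simp
    then have "summable (\<lambda>n. inverse (real (Suc n)))"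
    proof (rule summable_comparison_test'[where N = 0])
      fix n :: nat
      have "ln (2 ^ n + 1) \<le> ln (2 ^ Suc n :: real)" by (intro ln_mono) (auto intro: add_pos_pos)
      also have "\<dots> = real (Suc n) * ln 2" by (rule ln_realpow)
      finally have "ln (2 ^ n + 1) \<le> real (Suc n) * ln 2" .
      moreover have "ln (2 ^ n + 1 :: real) > 0" by (intro ln_gt_zero) simp
      ultimately show "norm (inverse (real (Suc n))) \<le> ln 2 * (1 / ln (2 ^ n + 1))"
        by (simp add: field_simps)
    qed
    then show False using not_summable_harmonic[where ?'a = real]
      by (subst (asm) summable_Suc_iff) simp
  qed
qed auto

text \<open>On the row \<open>n = 0\<close> the form takes the values \<open>- 2 * m^2\<close>, and putting
  \<open>m powr (- 1 / p) / ln (m + 1)\<close> there already makes the single value at \<open>0\<close> infinite.\<close>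

lemma lp_counterexample:
  fixes p :: real
  assumes p: "p > 1"
  obtains f where "\<And>k. f k \<ge> (0::real)" "lp_mem p f"
    "lp_normE p (Iw (- 2) 0 1 (\<lambda>m. \<bar>real_of_int m\<bar> powr (1 - 1 / p)) f) = \<infinity>"
proof
  define \<kappa> where "\<kappa> = (\<lambda>i. - 2 * (int i)^2)"
  \<comment> \<open>The \<open>p\<close>-th power carries \<open>ln powr p\<close> and is summable,
    whereas dividing \<open>h\<close> by the critical weight gives
    \<open>1 / (i * ln (i + 1))\<close>, which is not.\<close>
  define h where "h = (\<lambda>i. real i powr (- 1 / p) / ln (real i + 1))"
  have inj: "inj \<kappa>" by (auto simp: inj_def \<kappa>_def)
  have h0: "h i \<ge> 0" for i by (simp add: h_def)
  show "spread \<kappa> h k \<ge> 0" for k by (intro spread_nonneg h0)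
  have "h i powr p = 1 / (real i * ln (real i + 1) powr p)" for i
  proof (cases "i = 0")
    case False
    have "(real i powr (- 1 / p)) powr p = real i powr (- 1)"
      using p by (simp only: powr_powr) simp
    with False have "(real i powr (- 1 / p)) powr p = 1 / real i"
      by (simp add: powr_minus_divide)
    then show ?thesis by (simp add: h_def powr_divide)
  qed (simp add: h_def)
  then show "lp_mem p (spread \<kappa> h)"
    using summable_inverse_mult_ln_powr[OF p] by (intro lp_mem_spread inj h0) simp
  have "Iw (- 2) 0 1 (\<lambda>m. \<bar>real_of_int m\<bar> powr (1 - 1 / p)) (spread \<kappa> h) 0 = \<infinity>"
  proof (rule Iw_eq_top[OF not_summable_inverse_mult_ln])
    fix i :: nat assume i: "i > 0"
    have "qf (- 2) 0 1 (int i) 0 = \<kappa> i" by (simp add: qf_def \<kappa>_def)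
    moreover have "real i powr (- 1 / p) / real i powr (1 - 1 / p) = 1 / real i"
      using i by (simp flip: powr_diff)
    then have "h i / real i powr (1 - 1 / p) = 1 / (real i * ln (real i + 1))"
      unfolding h_def by (simp only: divide_divide_eq_left mult.commute[of "ln _"])
        (simp flip: divide_divide_eq_left)
    ultimately show "1 / (real i * ln (real i + 1)) \<le>
        spread \<kappa> h (qf (- 2) 0 1 (int i) 0) / \<bar>real_of_int (int i)\<bar> powr (1 - 1 / p)"
      by (simp add: spread_apply[OF inj])
  qed simp
  then show "lp_normE p (Iw (- 2) 0 1 (\<lambda>m. \<bar>real_of_int m\<bar> powr (1 - 1 / p)) (spread \<kappa> h)) = \<infinity>"
    by (rule lp_normE_top)
qed

section \<open>Integers with many representations, and the case \<open>p = 1\<close>\<close>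

text \<open>\<open>u\<close> lies in the ring generated by \<open>sqrt 2\<close>, and \<open>v\<close> is its conjugate.\<close>

definition conj_pair :: "real \<Rightarrow> real \<Rightarrow> bool" where
  "conj_pair u v \<longleftrightarrow> (\<exists>(x::int) (y::int). u = x + y * sqrt 2 \<and> v = x - y * sqrt 2)"

lemma conj_pair_1: "conj_pair 1 1"
  unfolding conj_pair_def by (intro exI[of _ 1] exI[of _ 0]) simp

lemma conj_pair_commute: "conj_pair u v \<Longrightarrow> conj_pair v u"
  unfolding conj_pair_def by (elim exE, rename_tac x y, rule_tac x = x in exI, rule_tac x = "- y" in exI) simp

lemma conj_pair_mult:
  assumes "conj_pair u v" "conj_pair u' v'"
  shows "conj_pair (u * u') (v * v')"
proof -
  obtain x y x' y' :: int where xy: "u = x + y * sqrt 2" "v = x - y * sqrt 2"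
    "u' = x' + y' * sqrt 2" "v' = x' - y' * sqrt 2"
    using assms unfolding conj_pair_def by blast
  have "u * u' = of_int (x * x' + 2 * y * y') + of_int (x * y' + y * x') * sqrt 2"
    "v * v' = of_int (x * x' + 2 * y * y') - of_int (x * y' + y * x') * sqrt 2"
    unfolding xy by (simp_all add: algebra_simps)
  then show ?thesis unfolding conj_pair_def by blast
qed

lemma conj_pair_power: "conj_pair u v \<Longrightarrow> conj_pair (u ^ n) (v ^ n)"
  by (induction n) (auto intro: conj_pair_1 conj_pair_mult)

lemma sqrt_2_coeffs_eq:
  fixes x y x' y' :: int
  assumes "x + y * sqrt 2 = x' + y' * sqrt 2"
  shows "x = x' \<and> y = y'"
proof -
  have "of_int (x - x') = of_int (y' - y) * sqrt 2" using assms by (simp add: algebra_simps)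
  then have "(of_int (x - x'))^2 = (of_int (y' - y) * sqrt 2)^2" by simp
  then have "real_of_int ((x - x')^2) = real_of_int (2 * (y' - y)^2)" by (simp add: power_mult_distrib)
  then have "(x - x')^2 - 2 * (y' - y)^2 = 0" by linarith
  moreover have "\<not> (\<exists>k::int. 2 = k^2)"
  proof
    assume "\<exists>k::int. 2 = k^2"
    then obtain k :: int where k: "k^2 = 2" by auto
    then have "\<bar>k\<bar>^2 < 2^2" by simp
    then have "\<bar>k\<bar> < 2" by (rule power2_less_imp_less) simp
    then have "k \<in> {-1, 0, 1}" by auto
    then show False using k by auto
  qed
  ultimately have "y' - y = 0" using nonsquare_imp_no_zero by blast
  with assms show ?thesis by simp
qed

text \<open>Under the ring homomorphism \<open>sqrt 2 \<mapsto> - t\<close> to the integers modulo \<open>t^2 - 2\<close> the powers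
  of \<open>t + sqrt 2\<close> vanish while those of its conjugate become powers of \<open>2 * t\<close>.\<close>

lemma power_coeffs_mod:
  fixes t :: int
  obtains p q :: int where "(t + sqrt 2) ^ d = p + q * sqrt 2" "(t - sqrt 2) ^ d = p - q * sqrt 2"
    "t^2 - 2 dvd p + t * q - (2 * t) ^ d" "d > 0 \<Longrightarrow> t^2 - 2 dvd p - t * q"
proof -
  have "\<exists>(p::int) (q::int). (t + sqrt 2) ^ d = p + q * sqrt 2 \<and> (t - sqrt 2) ^ d = p - q * sqrt 2 \<and>
    t^2 - 2 dvd p + t * q - (2 * t) ^ d \<and> (d > 0 \<longrightarrow> t^2 - 2 dvd p - t * q)"
  proof (induction d)
    case 0
    show ?case by (intro exI[of _ 1] exI[of _ 0]) simp
  next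
    case (Suc d)
    then obtain p q :: int where pq: "(t + sqrt 2) ^ d = p + q * sqrt 2" "(t - sqrt 2) ^ d = p - q * sqrt 2"
      "t^2 - 2 dvd p + t * q - (2 * t) ^ d" by blast
    have "(t + sqrt 2) ^ Suc d = of_int (t * p + 2 * q) + of_int (p + t * q) * sqrt 2"
      unfolding power_Suc pq by (simp add: algebra_simps)
    moreover have "(t - sqrt 2) ^ Suc d = of_int (t * p + 2 * q) - of_int (p + t * q) * sqrt 2"
      unfolding power_Suc pq by (simp add: algebra_simps)
    moreover have "(t * p + 2 * q) + t * (p + t * q) - (2 * t) ^ Suc d
        = 2 * t * (p + t * q - (2 * t) ^ d) - (t^2 - 2) * q"
      by (simp add: power2_eq_square algebra_simps)
    then have "t^2 - 2 dvd (t * p + 2 * q) + t * (p + t * q) - (2 * t) ^ Suc d"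
      using pq(3) by (metis dvd_diff dvd_mult dvd_triv_left)
    moreover have "(t * p + 2 * q) - t * (p + t * q) = (t^2 - 2) * (- q)"
      by (simp add: power2_eq_square algebra_simps)
    then have "t^2 - 2 dvd (t * p + 2 * q) - t * (p + t * q)" by (metis dvd_triv_left)
    ultimately show ?case by blast
  qed
  then show ?thesis using that by blast
qed

text \<open>Send \<open>sqrt 2\<close> to \<open>- t\<close> modulo \<open>N = t^2 - 2\<close>. The
  right side vanishes and the left becomes \<open>(x - t * y) * (2 * t) ^ d\<close>, where
  \<open>2 * t\<close> is a unit because \<open>t\<close> is odd. So \<open>N\<close> divides
  \<open>x - t * y\<close> and hence the norm \<open>x^2 - 2 * y^2 = k\<close>, against
  coprimality.\<close>

lemma no_power_collision:
  fixes t :: int and u v u' v' :: real and k :: int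
  assumes odd: "odd t" and t: "t > 1" and d: "d > 0"
    and z: "conj_pair u v" "u * v = of_int k" and z': "conj_pair u' v'"
    and cop: "coprime (t^2 - 2) k"
  shows "u * (t - sqrt 2) ^ d \<noteq> u' * (t + sqrt 2) ^ d"
proof
  assume eq: "u * (t - sqrt 2) ^ d = u' * (t + sqrt 2) ^ d"
  define N where "N = t^2 - 2"
  obtain p q where pq: "(t + sqrt 2) ^ d = of_int p + of_int q * sqrt 2"
    "(t - sqrt 2) ^ d = of_int p - of_int q * sqrt 2"
    "N dvd p + t * q - (2 * t) ^ d" "N dvd p - t * q"
    using power_coeffs_mod[of t d] d unfolding N_def by blast
  obtain x y x' y' :: int where xy: "u = x + y * sqrt 2" "v = x - y * sqrt 2" "u' = x' + y' * sqrt 2"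
    using z(1) z' unfolding conj_pair_def by blast
  have "of_int (x * p - 2 * y * q) + of_int (y * p - x * q) * sqrt 2
      = of_int (x' * p + 2 * y' * q) + of_int (x' * q + y' * p) * sqrt 2"
    using eq unfolding pq xy by (simp add: algebra_simps)
  then have e: "x * p - 2 * y * q = x' * p + 2 * y' * q" "y * p - x * q = x' * q + y' * p"
    using sqrt_2_coeffs_eq by blast+
  have "(x - t * y) * (p + t * q) = (x * p - 2 * y * q) - t * (y * p - x * q) - N * (y * q)"
    by (simp add: N_def power2_eq_square algebra_simps)
  also have "\<dots> = (p - t * q) * (x' - t * y') - N * (y' * q) - N * (y * q)"
    unfolding e by (simp add: N_def power2_eq_square algebra_simps)
  finally have eq1: "(x - t * y) * (p + t * q) = (p - t * q) * (x' - t * y') - N * (y' * q) - N * (y * q)" .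
  have "N dvd (x - t * y) * (p + t * q)" unfolding eq1 using pq(4) by (intro dvd_diff) auto
  moreover have "N dvd (x - t * y) * (p + t * q - (2 * t) ^ d)" using pq(3) by simp
  ultimately have "N dvd (x - t * y) * (p + t * q) - (x - t * y) * (p + t * q - (2 * t) ^ d)"
    by (rule dvd_diff)
  then have "N dvd (x - t * y) * (2 * t) ^ d" by (simp add: algebra_simps)
  moreover have "coprime N ((2 * t) ^ d)"
  proof -
    have odd_N: "coprime N 2" using odd by (simp add: N_def)
    have "is_unit c" if "c dvd N" "c dvd t" for c
    proof -
      have "c dvd t * t - N" using that by (intro dvd_diff) auto
      then have "c dvd 2" by (simp add: N_def power2_eq_square)
      then show ?thesis using odd_N that coprime_common_divisor by blast
    qed
    then have "coprime N t" by (rule coprimeI)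
    with odd_N show ?thesis by simp
  qed
  ultimately have "N dvd x - t * y" by (simp add: coprime_dvd_mult_left_iff)
  then have "N dvd (x - t * y) * (x + t * y) + N * y^2" by simp
  moreover have "(x - t * y) * (x + t * y) + N * y^2 = x^2 - 2 * y^2"
    by (simp add: N_def power2_eq_square algebra_simps)
  moreover have "real_of_int (x^2 - 2 * y^2) = real_of_int k"
    using z(2) xy by (simp add: power2_eq_square algebra_simps)
  then have "x^2 - 2 * y^2 = k" by (simp only: of_int_eq_iff)
  ultimately have "N dvd k" by simp
  then have "is_unit N" using cop by (metis N_def coprime_common_divisor dvd_refl)
  moreover have "N > 1"
  proof -
    have "2 * 2 \<le> t * t" using t by (intro mult_mono) auto
    then show ?thesis by (simp add: N_def power2_eq_square)
  qed
  ultimately show False by simp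
qed

text \<open>Conjugating some of the factors of \<open>A ^ s = (\<Prod>i<R. (t_i^2 - 2) ^ s)\<close>, where the
  \<open>t_i^2 - 2\<close> are pairwise coprime, gives a number of representations by \<open>x^2 - 2 * y^2\<close> that
  is polynomial in \<open>s\<close> of degree \<open>R\<close>, with coordinates of logarithmic size at most linear in \<open>s\<close>.\<close>

definition many_conj_pairs :: "nat \<Rightarrow> int \<Rightarrow> real \<Rightarrow> bool" where
  "many_conj_pairs R A B \<longleftrightarrow> (\<forall>s. \<exists>Z. finite Z \<and> card Z = (s + 1) ^ R \<and>
     (\<forall>(u, v)\<in>Z. conj_pair u v \<and> u * v = of_int (A ^ s) \<and> \<bar>u\<bar> \<le> B ^ s \<and> \<bar>v\<bar> \<le> B ^ s))"

text \<open>Each induction step brings in one new coprime factor. Oddness of \<open>A\<close> is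
  carried along to make the next \<open>t\<close> odd; \<open>A > 1\<close> is what later makes the
  powers \<open>A ^ s\<close> distinct.\<close>

lemma ex_many_conj_pairs:
  "\<exists>A B. odd A \<and> A \<ge> 1 \<and> (R > 0 \<longrightarrow> A > 1) \<and> B \<ge> 1 \<and> many_conj_pairs R A B"
proof (induction R)
  case 0
  show ?case
    unfolding many_conj_pairs_def
    by (intro exI[of _ 1] conjI allI exI[of _ "{(1, 1)}"]) (auto simp: conj_pair_1)
next
  case (Suc R)
  then obtain A B where A: "odd A" "A \<ge> 1" and B: "B \<ge> 1" and ex: "many_conj_pairs R A B"
    by blast
  \<comment> \<open>The factor \<open>A\<close> makes every common divisor of \<open>t^2 - 2\<close>
    and \<open>A\<close> divide 2, hence a unit because \<open>t^2 - 2\<close> is odd; the factor 3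
    ensures \<open>t \<ge> 3\<close>, so that \<open>t^2 - 2 > 1\<close> even for
    \<open>A = 1\<close>.\<close>
  define t where "t = 3 * A"
  define N where "N = t^2 - 2"
  define \<alpha> where "\<alpha> = t + sqrt 2"
  define \<alpha>' where "\<alpha>' = t - sqrt 2"
  have t: "odd t" "t \<ge> 3" using A by (auto simp: t_def)
  have sq2: "sqrt 2 < 2" by (simp add: real_less_lsqrt)
  have t3: "real_of_int t \<ge> 3" using t by simp
  define T where "T = real_of_int t + 2"
  have al: "\<alpha> > 0" "\<alpha>' > 0" "\<alpha> \<le> T" "\<alpha>' \<le> T"
    unfolding \<alpha>_def \<alpha>'_def T_def using t3 sq2 real_sqrt_ge_zero[of 2] by linarith+
  have al_mult: "\<alpha> * \<alpha>' = of_int N"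
    by (simp add: \<alpha>_def \<alpha>'_def N_def power2_eq_square algebra_simps)
  have cp: "conj_pair \<alpha> \<alpha>'"
    unfolding conj_pair_def \<alpha>_def \<alpha>'_def by (intro exI[of _ t] exI[of _ 1]) simp
  have N: "odd N" "N > 1"
  proof -
    have "3 * 3 \<le> t * t" using t by (intro mult_mono) auto
    then show "N > 1" "odd N" using t by (auto simp: N_def power2_eq_square)
  qed
  have copA: "coprime N A"
  proof (rule coprimeI)
    fix c assume c: "c dvd N" "c dvd A"
    then have "c dvd t * t - N" by (intro dvd_diff) (auto simp: t_def)
    then have "c dvd 2" by (simp add: N_def power2_eq_square)
    moreover have "coprime N 2" using N by simp
    ultimately show "is_unit c" using c coprime_common_divisor by blast
  qed
  have AN: "odd (A * N)" "A * N > 1" proof -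
    have "1 * N \<le> A * N" using A N by (intro mult_right_mono) auto
    with N(2) show "A * N > 1" by linarith
    show "odd (A * N)" using A N by simp
  qed
  have Bt: "B * T \<ge> 1" 
  proof -
    have "1 * 1 \<le> B * T" using B t3 by (intro mult_mono) (auto simp: T_def)
    then show ?thesis by simp
  qed
  have "many_conj_pairs (Suc R) (A * N) (B * T)"
    unfolding many_conj_pairs_def
  proof
    fix s
    obtain Z where Z: "finite Z" "card Z = (s + 1) ^ R"
      "\<forall>(u, v)\<in>Z. conj_pair u v \<and> u * v = of_int (A ^ s) \<and> \<bar>u\<bar> \<le> B ^ s \<and> \<bar>v\<bar> \<le> B ^ s"
      using ex unfolding many_conj_pairs_def by blast
    \<comment> \<open>Of the \<open>s\<close> copies of the new factor, \<open>e\<close> are taken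
      as \<open>\<alpha>\<close> and \<open>s - e\<close> as its conjugate. The norm is always
      multiplied by \<open>N ^ s\<close>, and the \<open>s + 1\<close> values of \<open>e\<close>
      raise the degree by one.\<close>
    define G where "G = (\<lambda>((u, v), e). (u * (\<alpha> ^ e * \<alpha>' ^ (s - e)), v * (\<alpha>' ^ e * \<alpha> ^ (s - e))))"
    have no: False
      if uv: "(u, v) \<in> Z" "(u', v') \<in> Z" and e: "e < e'" "e' \<le> s"
        and eq: "u * (\<alpha> ^ e * \<alpha>' ^ (s - e)) = u' * (\<alpha> ^ e' * \<alpha>' ^ (s - e'))" for u v u' v' e e'
    proof -
      \<comment> \<open>After the common powers are cancelled, a coincidence would be a collision of
        \<open>d\<close>-th powers of \<open>\<alpha>'\<close> and \<open>\<alpha>\<close>.\<close>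
      define d where "d = e' - e"
      have d: "d > 0" "e' = e + d" "s - e = (s - e') + d" using e by (auto simp: d_def)
      have "(\<alpha> ^ e * \<alpha>' ^ (s - e')) * (u * \<alpha>' ^ d) = (\<alpha> ^ e * \<alpha>' ^ (s - e')) * (u' * \<alpha> ^ d)"
        using eq unfolding d(3) unfolding d(2) by (simp only: power_add mult_ac)
      then have "u * \<alpha>' ^ d = u' * \<alpha> ^ d" using al by simp
      moreover have "coprime (t^2 - 2) (A ^ s)" using copA by (simp add: N_def)
      ultimately show False
        using no_power_collision[of t d u v "A ^ s" u' v'] bspec[OF Z(3) uv(1)] bspec[OF Z(3) uv(2)] t d(1)
        unfolding \<alpha>_def \<alpha>'_def by simp
    qed
    have inj: "inj_on G (Z \<times> {..s})"
    proof (rule inj_onI)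
      fix z z' assume zz: "z \<in> Z \<times> {..s}" "z' \<in> Z \<times> {..s}" and eq: "G z = G z'"
      obtain u v e u' v' e' where z: "z = ((u, v), e)" "z' = ((u', v'), e')"
        by (metis prod.collapse)
      have eqs: "u * (\<alpha> ^ e * \<alpha>' ^ (s - e)) = u' * (\<alpha> ^ e' * \<alpha>' ^ (s - e'))"
        "v * (\<alpha>' ^ e * \<alpha> ^ (s - e)) = v' * (\<alpha>' ^ e' * \<alpha> ^ (s - e'))"
        using eq by (auto simp: G_def z)
      have "e = e'"
        using no[of u v u' v' e e'] no[of u' v' u v e' e] zz eqs(1) z
        by (cases e e' rule: linorder_cases) auto
      then show "z = z'" using eqs al z by simp
    qed
    show "\<exists>Z. finite Z \<and> card Z = (s + 1) ^ Suc R \<and>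
      (\<forall>(u, v)\<in>Z. conj_pair u v \<and> u * v = of_int ((A * N) ^ s) \<and>
        \<bar>u\<bar> \<le> (B * T) ^ s \<and> \<bar>v\<bar> \<le> (B * T) ^ s)"
    proof (intro exI[of _ "G ` (Z \<times> {..s})"] conjI ballI)
      show "finite (G ` (Z \<times> {..s}))" using Z by simp
      show "card (G ` (Z \<times> {..s})) = (s + 1) ^ Suc R"
        using card_image[OF inj] Z by (simp add: card_cartesian_product)
      fix y assume "y \<in> G ` (Z \<times> {..s})"
      then obtain u v e where uv: "(u, v) \<in> Z" and e: "e \<le> s"
        and y: "y = (u * (\<alpha> ^ e * \<alpha>' ^ (s - e)), v * (\<alpha>' ^ e * \<alpha> ^ (s - e)))"
        by (auto simp: G_def)
      have Zuv: "conj_pair u v" "u * v = of_int (A ^ s)" "\<bar>u\<bar> \<le> B ^ s" "\<bar>v\<bar> \<le> B ^ s"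
        using Z(3) uv by auto
      have 1: "conj_pair (u * (\<alpha> ^ e * \<alpha>' ^ (s - e))) (v * (\<alpha>' ^ e * \<alpha> ^ (s - e)))"
        by (intro conj_pair_mult conj_pair_power cp conj_pair_commute[OF cp] Zuv)
      have "u * (\<alpha> ^ e * \<alpha>' ^ (s - e)) * (v * (\<alpha>' ^ e * \<alpha> ^ (s - e)))
          = (u * v) * ((\<alpha> * \<alpha>') ^ e * (\<alpha> * \<alpha>') ^ (s - e))"
        by (simp only: power_mult_distrib mult_ac)
      also have "\<dots> = of_int ((A * N) ^ s)"
        using e Zuv(2) al_mult by (simp add: power_mult_distrib flip: power_add)
      finally have 2: "u * (\<alpha> ^ e * \<alpha>' ^ (s - e)) * (v * (\<alpha>' ^ e * \<alpha> ^ (s - e))) = of_int ((A * N) ^ s)" .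
      have bd: "\<bar>w * (x ^ e * x' ^ (s - e))\<bar> \<le> (B * T) ^ s"
        if "\<bar>w\<bar> \<le> B ^ s" "0 < x" "x \<le> T" "0 < x'" "x' \<le> T" for w x x' :: real
      proof -
        have "x ^ e * x' ^ (s - e) \<le> T ^ e * T ^ (s - e)"
          using that t3 by (intro mult_mono power_mono) (auto simp: T_def)
        also have "\<dots> = T ^ s" using e by (simp flip: power_add)
        finally have "x ^ e * x' ^ (s - e) \<le> T ^ s" .
        then have "\<bar>w\<bar> * (x ^ e * x' ^ (s - e)) \<le> B ^ s * T ^ s"
          using that B by (intro mult_mono) auto
        then show ?thesis using that by (simp add: abs_mult power_mult_distrib)
      qed
      show "case y of (u, v) \<Rightarrow> conj_pair u v \<and> u * v = of_int ((A * N) ^ s) \<and>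
        \<bar>u\<bar> \<le> (B * T) ^ s \<and> \<bar>v\<bar> \<le> (B * T) ^ s"
        unfolding y using 1 2 bd al Zuv by simp
    qed
  qed
  with AN Bt show ?case by (intro exI[of _ "A * N"] exI[of _ "B * T"]) simp
qed

lemma ex_many_representations:
  obtains A :: int and B :: real where "A \<ge> 1" "R > 0 \<Longrightarrow> A > 1" "B \<ge> 1"
    "\<And>s. \<exists>P :: (int \<times> int) set. finite P \<and> card P = (s + 1) ^ R \<and>
      (\<forall>(n, m)\<in>P. n^2 - 2 * m^2 = A ^ s \<and> \<bar>real_of_int m\<bar> \<le> B ^ s)"
proof -
  obtain A B where AB: "A \<ge> 1" "R > 0 \<Longrightarrow> A > 1" "B \<ge> 1" and ex: "many_conj_pairs R A B"
    using ex_many_conj_pairs[of R] by blast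
  show ?thesis
  proof (rule that[OF AB])
    fix s
    obtain Z where Z: "finite Z" "card Z = (s + 1) ^ R"
      "\<forall>(u, v)\<in>Z. conj_pair u v \<and> u * v = of_int (A ^ s) \<and> \<bar>u\<bar> \<le> B ^ s \<and> \<bar>v\<bar> \<le> B ^ s"
      using ex unfolding many_conj_pairs_def by blast
    define enc where "enc = (\<lambda>(n::int, m::int). (n + m * sqrt 2, n - m * sqrt 2))"
    define P where "P = enc -` Z"
    have inj: "inj enc" by (auto simp: inj_def enc_def dest: sqrt_2_coeffs_eq)
    have "Z \<subseteq> range enc"
    proof
      fix z assume "z \<in> Z"
      then have "conj_pair (fst z) (snd z)" using Z(3) by auto
      then show "z \<in> range enc" unfolding conj_pair_def enc_def by (cases z) auto
    qed
    then have "finite P" "card P = card Z"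
      using Z(1) inj by (simp_all add: P_def finite_vimageI card_vimage_inj)
    moreover have "n^2 - 2 * m^2 = A ^ s \<and> \<bar>real_of_int m\<bar> \<le> B ^ s" if "(n, m) \<in> P" for n m
    proof
      have uv: "(n + m * sqrt 2) * (n - m * sqrt 2) = of_int (A ^ s)"
        "\<bar>n + m * sqrt 2\<bar> \<le> B ^ s" "\<bar>n - m * sqrt 2\<bar> \<le> B ^ s"
        using that Z(3) by (auto simp: P_def enc_def)
      have "real_of_int (n^2 - 2 * m^2) = real_of_int (A ^ s)"
        using uv(1) by (simp add: power2_eq_square algebra_simps)
      then show "n^2 - 2 * m^2 = A ^ s" by (simp only: of_int_eq_iff)
      \<comment> \<open>\<open>m * sqrt 2\<close> is half the difference of the two conjugates, so
        it inherits their bound.\<close>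
      have "\<bar>real_of_int m\<bar> * 1 \<le> \<bar>real_of_int m\<bar> * sqrt 2" by (intro mult_left_mono) auto
      also have "\<dots> = \<bar>m * sqrt 2\<bar>" by (simp add: abs_mult)
      also have "\<dots> \<le> B ^ s" using uv(2,3) by linarith
      finally show "\<bar>real_of_int m\<bar> \<le> B ^ s" by simp
    qed
    ultimately show "\<exists>P :: (int \<times> int) set. finite P \<and> card P = (s + 1) ^ R \<and>
      (\<forall>(n, m)\<in>P. n^2 - 2 * m^2 = A ^ s \<and> \<bar>real_of_int m\<bar> \<le> B ^ s)"
      using Z(2) by (intro exI[of _ P]) auto
  qed
qed

lemma log_counterexample:
  obtains f where "\<And>k. f k \<ge> (0::real)" "lp_mem 1 f"
    "lp_normE 1 (Iw (- 2) 0 1 (\<lambda>m. (ln (1 + \<bar>real_of_int m\<bar>)) ^ r) f) = \<infinity>"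
proof -
  \<comment> \<open>At \<open>A ^ s\<close> about \<open>(s + 1) ^ R\<close> pairs contribute
    \<open>(s + 1) powr (- 2)\<close> each, divided by a weight of order at most
    \<open>(s + 1) ^ r\<close>. The choice \<open>R = r + 3\<close> leaves one factor
    \<open>s + 1\<close>, which is unbounded.\<close>
  define R where "R = r + 3"
  obtain A :: int and B :: real where AB: "A \<ge> 1" "A > 1" "B \<ge> 1" and
    ex: "\<And>s. \<exists>P :: (int \<times> int) set. finite P \<and> card P = (s + 1) ^ R \<and>
      (\<forall>(n, m)\<in>P. n^2 - 2 * m^2 = A ^ s \<and> \<bar>real_of_int m\<bar> \<le> B ^ s)"
    using ex_many_representations[of R] unfolding R_def by auto
  define \<kappa> where "\<kappa> = (\<lambda>s::nat. A ^ s)"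
  define h where "h = (\<lambda>s::nat. 1 / (real s + 1)^2)"
  have inj: "inj \<kappa>" using AB by (auto simp: inj_def \<kappa>_def power_inject_exp)
  have h0: "h s \<ge> 0" for s by (simp add: h_def)
  define f where "f = spread \<kappa> h"
  \<comment> \<open>Chosen so that
    \<open>ln (1 + B ^ s) \<le> ln 2 + s * ln B \<le> (s + 1) * L\<close>.\<close>
  define L where "L = ln 2 + ln B"
  have L: "L > 0" using AB by (simp add: L_def add_pos_nonneg)
  define w where "w = (\<lambda>m. (ln (1 + \<bar>real_of_int m\<bar>)) ^ r)"
  show ?thesis
  proof (rule that[of f])
    show "f k \<ge> 0" for k unfolding f_def by (intro spread_nonneg h0)
    have "summable (\<lambda>s. inverse (real (Suc s) ^ 2))"
      by (subst summable_Suc_iff) (rule inverse_power_summable, simp)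
    then show "lp_mem 1 f"
      unfolding f_def by (intro lp_mem_spread inj h0) (simp add: h_def divide_inverse add.commute)
    have "lp_normE 1 (Iw (- 2) 0 1 w f) = \<infinity>"
    proof (rule lp_normE_1_Iw_eq_top)
      fix M :: real
      obtain s :: nat where s: "s \<ge> 1" "2 * L ^ r * M \<le> real s + 1"
      proof -
        obtain s0 :: nat where "2 * L ^ r * M \<le> real s0" using real_arch_simple by blast
        then show ?thesis using that[of "Suc s0"] by simp
      qed
      obtain P :: "(int \<times> int) set" where P: "finite P" "card P = (s + 1) ^ R"
        "\<forall>(n, m)\<in>P. n^2 - 2 * m^2 = A ^ s \<and> \<bar>real_of_int m\<bar> \<le> B ^ s"
        using ex[of s] by blast
      \<comment> \<open>Representations with \<open>m = 0\<close> are not seen by the operator.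
        There are at most two, and \<open>(s + 1) ^ R \<ge> 4\<close>, so at least half of
        \<open>P\<close> remains.\<close>
      define E where "E = {z \<in> P. snd z = 0}"
      define F where "F = P - E"
      have "card E \<le> 2"
      proof (cases "E = {}")
        case False
        then obtain n0 where n0: "(n0, 0) \<in> P" by (auto simp: E_def)
        have "E \<subseteq> {(n0, 0), (- n0, 0)}"
        proof
          fix z assume "z \<in> E"
          then obtain n where z: "z = (n, 0)" "(n, 0) \<in> P" by (auto simp: E_def) (metis prod.collapse)
          then have "n^2 = n0^2" using bspec[OF P(3) z(2)] bspec[OF P(3) n0] by simp
          then show "z \<in> {(n0, 0), (- n0, 0)}" using z by (auto simp: power2_eq_iff)
        qed
        then have "card E \<le> card {(n0, 0::int), (- n0, 0)}" by (intro card_mono) auto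
        also have "\<dots> \<le> 2" by (simp add: card_insert_if)
        finally show ?thesis .
      qed simp
      moreover have "card F = card P - card E"
        unfolding F_def using P(1) by (intro card_Diff_subset) (auto simp: E_def)
      moreover have "4 \<le> (s + 1) ^ R"
      proof -
        have "(2::nat) ^ 2 \<le> 2 ^ R" by (intro power_increasing) (auto simp: R_def)
        also have "\<dots> \<le> (s + 1) ^ R" using s by (intro power_mono) auto
        finally show ?thesis by simp
      qed
      ultimately have "(s + 1) ^ R \<le> 2 * card F" using P(2) by linarith
      then have cardF: "(real s + 1) ^ R / 2 \<le> real (card F)"
        by (metis (mono_tags, lifting) add.commute divide_le_eq_numeral1(1) mult.commute of_nat_Suc of_nat_le_iff of_nat_mult of_nat_numeral of_nat_power plus_1_eq_Suc)
      have trm: "1 / ((real s + 1)^2 * ((real s + 1) * L) ^ r) \<le> f (qf (- 2) 0 1 m n) / w m"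
        "f (qf (- 2) 0 1 m n) / w m \<ge> 0" if "(n, m) \<in> F" for n m
      proof -
        have nm: "(n, m) \<in> P" "m \<noteq> 0" using that by (auto simp: F_def E_def)
        then have "qf (- 2) 0 1 m n = \<kappa> s" using P(3) by (auto simp: qf_def \<kappa>_def)
        then have fq: "f (qf (- 2) 0 1 m n) = 1 / (real s + 1)^2"
          unfolding f_def by (simp add: spread_apply[OF inj] h_def)
        have l0: "ln (1 + \<bar>real_of_int m\<bar>) > 0" using nm by (intro ln_gt_zero) simp
        have "ln (1 + \<bar>real_of_int m\<bar>) \<le> ln (2 * B ^ s)"
        proof (intro ln_mono)
          have "1 \<le> B ^ s" using AB by simp
          moreover have "\<bar>real_of_int m\<bar> \<le> B ^ s" using nm P(3) by auto
          ultimately show "1 + \<bar>real_of_int m\<bar> \<le> 2 * B ^ s" by linarith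
        qed (use AB in auto)
        also have "\<dots> = ln 2 + real s * ln B" using AB by (simp add: ln_mult ln_realpow)
        also have "\<dots> \<le> (real s + 1) * L" using AB by (simp add: L_def algebra_simps)
        finally have wle: "w m \<le> ((real s + 1) * L) ^ r"
          unfolding w_def using l0 by (intro power_mono) auto
        have w0: "w m > 0" unfolding w_def using l0 by simp
        show "f (qf (- 2) 0 1 m n) / w m \<ge> 0" using w0 fq by simp
        have "1 / ((real s + 1)^2 * ((real s + 1) * L) ^ r) \<le> 1 / ((real s + 1)^2 * w m)"
          using wle w0 L by (intro divide_left_mono mult_left_mono mult_pos_pos) auto
        then show "1 / ((real s + 1)^2 * ((real s + 1) * L) ^ r) \<le> f (qf (- 2) 0 1 m n) / w m"
          by (simp add: fq)
      qed
      have "M \<le> (real s + 1) / (2 * L ^ r)" using s L by (simp add: pos_le_divide_eq mult.commute)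
      also have "\<dots> = (real s + 1) ^ R / 2 * (1 / ((real s + 1)^2 * ((real s + 1) * L) ^ r))"
      proof -
        have "(real s + 1) ^ R = (real s + 1) * ((real s + 1)^2 * (real s + 1) ^ r)"
          by (simp add: R_def power_add power2_eq_square power3_eq_cube)
        then show ?thesis using L by (simp add: power_mult_distrib add_nonneg_eq_0_iff)
      qed
      also have "\<dots> \<le> real (card F) * (1 / ((real s + 1)^2 * ((real s + 1) * L) ^ r))"
        using cardF L by (intro mult_right_mono) auto
      also have "\<dots> = (\<Sum>z\<in>F. 1 / ((real s + 1)^2 * ((real s + 1) * L) ^ r))" by simp
      also have "\<dots> \<le> (\<Sum>(n, m)\<in>F. f (qf (- 2) 0 1 m n) / w m)"
        using trm(1) by (intro sum_mono) auto
      finally have "M \<le> (\<Sum>(n, m)\<in>F. f (qf (- 2) 0 1 m n) / w m)" .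
      moreover have "finite F" "F \<subseteq> UNIV \<times> (UNIV - {0})"
        using P(1) by (auto simp: F_def E_def)
      ultimately show "\<exists>F. finite F \<and> F \<subseteq> UNIV \<times> (UNIV - {0}) \<and>
          (\<forall>(n, m)\<in>F. f (qf (- 2) 0 1 m n) / w m \<ge> 0) \<and>
          M \<le> (\<Sum>(n, m)\<in>F. f (qf (- 2) 0 1 m n) / w m)"
        using trm(2) by (intro exI[of _ F]) auto
    qed
    then show "lp_normE 1 (Iw (- 2) 0 1 (\<lambda>m. (ln (1 + \<bar>real_of_int m\<bar>)) ^ r) f) = \<infinity>"
      by (simp add: w_def)
  qed
qed

theorem theorem2:
  shows
   "(\<forall>(p::real) (lam::real) (D::int).
       1 \<le> p \<and> lam > 1 - 1 / p \<and> D > 0 \<and> \<not> (\<exists>k::int. D = k^2) \<longrightarrow>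
       (\<exists>C::real. \<forall>a b c. disc a b c = D \<longrightarrow>
          (\<forall>f::int \<Rightarrow> complex. lp_mem p f \<longrightarrow>
             (\<forall>n. (\<lambda>m. f (qf a b c m n) / complex_of_real (\<bar>real_of_int m\<bar> powr lam))
                    summable_on (UNIV - {0})) \<and>
             lp_mem p (Ilam a b c lam f) \<and>
             lp_norm p (Ilam a b c lam f) \<le> C * lp_norm p f)))
  \<and> (\<forall>(lam::real) (D::int).
       lam > 1 \<and> D > 0 \<and> \<not> (\<exists>k::int. D = k^2) \<longrightarrow>
       (\<exists>C::real. \<forall>a b c. disc a b c = D \<longrightarrow>
          (\<forall>f::int \<Rightarrow> complex. linf_mem f \<longrightarrow>
             (\<forall>n. (\<lambda>m. f (qf a b c m n) / complex_of_real (\<bar>real_of_int m\<bar> powr lam))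
                    summable_on (UNIV - {0})) \<and>
             linf_mem (Ilam a b c lam f) \<and>
             linf_norm (Ilam a b c lam f) \<le> C * linf_norm f)))
  \<and> (\<forall>r::nat. \<exists>a b c (f::int \<Rightarrow> real).
       good_form a b c \<and> (\<forall>k. f k \<ge> 0) \<and> lp_mem 1 f \<and>
       lp_normE 1 (Iw a b c (\<lambda>m. (ln (1 + \<bar>real_of_int m\<bar>)) ^ r) f) = \<infinity>)
  \<and> (\<forall>p::real. 1 < p \<longrightarrow> (\<exists>a b c (f::int \<Rightarrow> real).
       good_form a b c \<and> (\<forall>k. f k \<ge> 0) \<and> lp_mem p f \<and>
       lp_normE p (Iw a b c (\<lambda>m. \<bar>real_of_int m\<bar> powr (1 - 1 / p)) f) = \<infinity>))
  \<and> (\<exists>a b c (f::int \<Rightarrow> real).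
       good_form a b c \<and> (\<forall>k. f k \<ge> 0) \<and> linf_mem f \<and>
       linf_normE (Iw a b c (\<lambda>m. \<bar>real_of_int m\<bar>) f) = \<infinity>)"
proof (intro conjI)
  show "\<forall>(p::real) (lam::real) (D::int).
       1 \<le> p \<and> lam > 1 - 1 / p \<and> D > 0 \<and> \<not> (\<exists>k::int. D = k^2) \<longrightarrow>
       (\<exists>C::real. \<forall>a b c. disc a b c = D \<longrightarrow>
          (\<forall>f::int \<Rightarrow> complex. lp_mem p f \<longrightarrow>
             (\<forall>n. (\<lambda>m. f (qf a b c m n) / complex_of_real (\<bar>real_of_int m\<bar> powr lam))
                    summable_on (UNIV - {0})) \<and>
             lp_mem p (Ilam a b c lam f) \<and>
             lp_norm p (Ilam a b c lam f) \<le> C * lp_norm p f))"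
  proof (intro allI impI, elim conjE)
    fix p lam :: real and D :: int
    assume "1 \<le> p" "lam > 1 - 1 / p" "D > 0" "\<not> (\<exists>k::int. D = k^2)"
    then show "\<exists>C::real. \<forall>a b c. disc a b c = D \<longrightarrow>
          (\<forall>f::int \<Rightarrow> complex. lp_mem p f \<longrightarrow>
             (\<forall>n. (\<lambda>m. f (qf a b c m n) / complex_of_real (\<bar>real_of_int m\<bar> powr lam))
                    summable_on (UNIV - {0})) \<and>
             lp_mem p (Ilam a b c lam f) \<and>
             lp_norm p (Ilam a b c lam f) \<le> C * lp_norm p f)"
      by (rule bounded_lp)
  qed
  show "\<forall>(lam::real) (D::int).
       lam > 1 \<and> D > 0 \<and> \<not> (\<exists>k::int. D = k^2) \<longrightarrow>
       (\<exists>C::real. \<forall>a b c. disc a b c = D \<longrightarrow>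
          (\<forall>f::int \<Rightarrow> complex. linf_mem f \<longrightarrow>
             (\<forall>n. (\<lambda>m. f (qf a b c m n) / complex_of_real (\<bar>real_of_int m\<bar> powr lam))
                    summable_on (UNIV - {0})) \<and>
             linf_mem (Ilam a b c lam f) \<and>
             linf_norm (Ilam a b c lam f) \<le> C * linf_norm f))"
  proof (intro allI impI, elim conjE)
    fix lam :: real and D :: int
    assume "lam > 1"
    then show "\<exists>C::real. \<forall>a b c. disc a b c = D \<longrightarrow>
          (\<forall>f::int \<Rightarrow> complex. linf_mem f \<longrightarrow>
             (\<forall>n. (\<lambda>m. f (qf a b c m n) / complex_of_real (\<bar>real_of_int m\<bar> powr lam))
                    summable_on (UNIV - {0})) \<and>
             linf_mem (Ilam a b c lam f) \<and>
             linf_norm (Ilam a b c lam f) \<le> C * linf_norm f)"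
      using bounded_linf by blast
  qed
  show "\<forall>r::nat. \<exists>a b c (f::int \<Rightarrow> real).
       good_form a b c \<and> (\<forall>k. f k \<ge> 0) \<and> lp_mem 1 f \<and>
       lp_normE 1 (Iw a b c (\<lambda>m. (ln (1 + \<bar>real_of_int m\<bar>)) ^ r) f) = \<infinity>"
  proof
    fix r :: nat
    obtain f where "\<And>k. f k \<ge> (0::real)" "lp_mem 1 f"
      "lp_normE 1 (Iw (- 2) 0 1 (\<lambda>m. (ln (1 + \<bar>real_of_int m\<bar>)) ^ r) f) = \<infinity>"
      using log_counterexample[of r] by blast
    with good_form_neg2_0_1 show "\<exists>a b c (f::int \<Rightarrow> real).
       good_form a b c \<and> (\<forall>k. f k \<ge> 0) \<and> lp_mem 1 f \<and>
       lp_normE 1 (Iw a b c (\<lambda>m. (ln (1 + \<bar>real_of_int m\<bar>)) ^ r) f) = \<infinity>"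
      by blast
  qed
  show "\<forall>p::real. 1 < p \<longrightarrow> (\<exists>a b c (f::int \<Rightarrow> real).
       good_form a b c \<and> (\<forall>k. f k \<ge> 0) \<and> lp_mem p f \<and>
       lp_normE p (Iw a b c (\<lambda>m. \<bar>real_of_int m\<bar> powr (1 - 1 / p)) f) = \<infinity>)"
  proof (intro allI impI)
    fix p :: real assume "1 < p"
    then obtain f where "\<And>k. f k \<ge> (0::real)" "lp_mem p f"
      "lp_normE p (Iw (- 2) 0 1 (\<lambda>m. \<bar>real_of_int m\<bar> powr (1 - 1 / p)) f) = \<infinity>"
      using lp_counterexample[of p] by blast
    with good_form_neg2_0_1 show "\<exists>a b c (f::int \<Rightarrow> real).
       good_form a b c \<and> (\<forall>k. f k \<ge> 0) \<and> lp_mem p f \<and>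
       lp_normE p (Iw a b c (\<lambda>m. \<bar>real_of_int m\<bar> powr (1 - 1 / p)) f) = \<infinity>"
      by blast
  qed
  have "linf_mem (\<lambda>_. 1 :: real)" by (simp add: linf_mem_def image_def)
  with good_form_neg2_0_1 linf_counterexample show "\<exists>a b c (f::int \<Rightarrow> real).
       good_form a b c \<and> (\<forall>k. f k \<ge> 0) \<and> linf_mem f \<and>
       linf_normE (Iw a b c (\<lambda>m. \<bar>real_of_int m\<bar>) f) = \<infinity>"
    by (intro exI[of _ "- 2"] exI[of _ 0] exI[of _ 1] exI[of _ "\<lambda>_. 1"]) simp
qed

end
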